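(* Let $P$ be a labeled $n$-gon in $\mathbb{R}^2$, and assume the following. (i) There are an integer $m\ge1$, a real projectivity $G$, and a cyclic relabelling $\Sigma_s$ (with $s=0$ allowed) such that $T^m(P)=\Sigma_s(G(P))$. All forward pentagram iterates of $P$ are defined and have nonzero unsigned area. (ii) A real matrix $\widetilde G\in\mathrm{GL}(3,\mathbb{R})$ representing $G$ has one simple real eigenvalue $\lambda_1$ and one non-real conjugate pair $\lambda_{2,3}=\rho e^{\pm\mathrm i\theta}$, $\rho>0$, $0<\theta<\pi$, with $|\lambda_1|>\rho$. Let $v_1\in\mathbb{R}^3$ be a real eigenvector for $\lambda_1$ and $X_1=[v_1]\in\mathbb{RP}^2$. The point $X_1$ belongs to the fixed affine chart $\mathbb{R}^2\subset\mathbb{RP}^2$. Let $f$ denote the affine expression of $G$ on a neighborhood of $X_1$, put $\tau=\rho/|\lambda_1|<1$, and choose $\vartheta$ modulo $2\pi$ with $\lambda_2/\lambda_1=\tau e^{\mathrm i\vartheta}$. (iii) For each $r=0,\ldots,m-1$ put $Q_r=T^r(P)=(q_{r,1},\dots,q_{r,n})$. Each $Q_r$ is in regular spectral position with respect to $G$: for every homogeneous vertex lift, its spectral projection onto $\mathbb{R}v_1$, along the real invariant plane associated with $\lambda_2$ and $\lambda_3$, is nonzero. Put $M=\mathrm Df_{X_1}$, $R=\tau^{-1}M$, and define $\xi_{r,i}\in\mathbb{R}^2$ by the first-order expansion $$f^q(q_{r,i})=X_1+\tau^qR^q\xi_{r,i}+O(\tau^{2q})\qquad(q\to\infty),$$ and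 set $$w_{r,i}=\xi_{r,i}-\frac1n\sum_j\xi_{r,j},\qquad B_r=\left|\frac12\sum_i\det(w_{r,i},w_{r,i+1})\right|.$$ Assume $w_{r,i}\ne0$ for every $i$ and $B_r>0$. Let $P_k=\widehat T^k(P)$, $C_0=C(P)$, $A_0=\operatorname{Area}(P)$, and $\widetilde P_{q,r}=\Sigma_{-qs}(P_{qm+r})=(\widetilde p_{q,r,1},\dots,\widetilde p_{q,r,n})$. Then for every $r=0,\ldots,m-1$ and every $i$, as $q\to\infty$, $$\widetilde p_{q,r,i}-C_0=\sqrt{\frac{A_0}{B_r}}\,R^qw_{r,i}+o(1).$$ The matrix $R$ has eigenvalues $e^{\pm\mathrm i\vartheta}$ and $\det R=1$. There is a positive definite quadratic form $\mathcal Q$ on $\mathbb{R}^2$, independent of $r$, for which $R$ is a rotation (in particular $\mathcal Q(Rx)=\mathcal Q(x)$). Consequently $$\mathcal Q(\widetilde p_{q,r,i}-C_0)\to\frac{A_0}{B_r}\mathcal Q(w_{r,i})\qquad(q\to\infty).$$ Thus, for every fixed residue class $r$ and vertex $i$, the relabelled area-normalized vertices are asymptotic to a level set of one positive definite quadratic form.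
   Context: Labeled polygons: $P=(p_1,\dots,p_n)$ with $p_i\in\mathbb{R}^2$, indices modulo $n$; $\mathbb{R}^2\subset\mathbb{RP}^2$ via $x\mapsto[x:1]$. The pentagram map is $T(P)_i=(p_ip_{i+2})\cap(p_{i+1}p_{i+3})$, defined when, for every $i$, these two lines are well defined and not parallel; $T^k$ is its $k$-th iterate. Put $C(P)=\frac1n\sum_i p_i$ and $\operatorname{Area}(P)=\bigl|\frac12\sum_i\det(p_i,p_{i+1})\bigr|$. The area-normalized pentagram map is $$\widehat T(P)_i=C(P)+\sqrt{\tfrac{\operatorname{Area}(P)}{\operatorname{Area}(T(P))}}\,\bigl(T(P)_i-C(T(P))\bigr),$$ defined when $T(P)$ is defined and both areas are nonzero. Cyclic relabelling: $\Sigma_s(P)_i=p_{i+s}$. A projectivity is a projective transformation of $\mathbb{RP}^2$ given by a real invertible $3\times3$ matrix, acting on polygons vertexwise; $f^q(q_{r,i})$ denotes the affine point $G^q(q_{r,i})$. $\det$ of two vectors is the standard determinant in the chosen affine coordinate plane $\mathbb{R}^2$. *)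

theory Defs
  imports
    "HOL-Analysis.Analysis"
    "HOL-Computational_Algebra.Polynomial"
    "HOL-Library.Landau_Symbols"
begin

section \<open>Labeled polygons and the pentagram map\<close>

text \<open>A labeled n-gon is an n-periodic family of points, so that index arithmetic modulo n is
  ordinary integer arithmetic; the vertices are those with indices 1, ..., n.\<close>

definition polygon :: "nat \<Rightarrow> (int \<Rightarrow> real^2) \<Rightarrow> bool" where
  "polygon n P \<longleftrightarrow> n \<ge> 1 \<and> (\<forall>i. P (i + int n) = P i)"

definition relabel :: "int \<Rightarrow> (int \<Rightarrow> 'a) \<Rightarrow> int \<Rightarrow> 'a" where
  "relabel s P = (\<lambda>i. P (i + s))"

definition centroid :: "nat \<Rightarrow> (int \<Rightarrow> real^2) \<Rightarrow> real^2" where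
  "centroid n P = (1 / real n) *\<^sub>R (\<Sum>i=1..int n. P i)"

definition det2 :: "real^2 \<Rightarrow> real^2 \<Rightarrow> real" where
  "det2 u v = det (vector [u, v] :: real^2^2)"

definition area :: "nat \<Rightarrow> (int \<Rightarrow> real^2) \<Rightarrow> real" where
  "area n P = \<bar>1 / 2 * (\<Sum>i=1..int n. det2 (P i) (P (i + 1)))\<bar>"

definition line_through :: "real^2 \<Rightarrow> real^2 \<Rightarrow> (real^2) set" where
  "line_through a b = affine hull {a, b}"

text \<open>\<^const>\<open>affine_parallel\<close> is reflexive: coincident lines count as parallel.\<close>

definition pentagram_defined :: "(int \<Rightarrow> real^2) \<Rightarrow> bool" where
  "pentagram_defined P \<longleftrightarrow>
     (\<forall>i. P i \<noteq> P (i + 2) \<and> P (i + 1) \<noteq> P (i + 3) \<and>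
       \<not> affine_parallel (line_through (P i) (P (i + 2))) (line_through (P (i + 1)) (P (i + 3))))"

text \<open>Total function; meaningful only under \<^const>\<open>pentagram_defined\<close>.\<close>

definition pentagram :: "(int \<Rightarrow> real^2) \<Rightarrow> int \<Rightarrow> real^2" where
  "pentagram P = (\<lambda>i. THE x.
     x \<in> line_through (P i) (P (i + 2)) \<inter> line_through (P (i + 1)) (P (i + 3)))"

definition normalized_pentagram_defined :: "nat \<Rightarrow> (int \<Rightarrow> real^2) \<Rightarrow> bool" where
  "normalized_pentagram_defined n P \<longleftrightarrow>
     pentagram_defined P \<and> area n P \<noteq> 0 \<and> area n (pentagram P) \<noteq> 0"

definition normalized_pentagram :: "nat \<Rightarrow> (int \<Rightarrow> real^2) \<Rightarrow> int \<Rightarrow> real^2" where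
  "normalized_pentagram n P = (\<lambda>i. centroid n P +
     sqrt (area n P / area n (pentagram P)) *\<^sub>R (pentagram P i - centroid n (pentagram P)))"


section \<open>The real projective plane\<close>

typedef rp2 = "{L :: (real^3) set. subspace L \<and> dim L = 1}"
  by (rule exI[of _ "span {axis 1 1}"]) simp

text \<open>The point \<open>[v]\<close>; meaningful for \<open>v \<noteq> 0\<close>.\<close>

definition proj_pt :: "real^3 \<Rightarrow> rp2" where
  "proj_pt v = Abs_rp2 (span {v})"

definition aff_pt :: "real^2 \<Rightarrow> rp2" where
  "aff_pt x = proj_pt (vector [x$1, x$2, 1])"

definition represents_projectivity :: "real^3^3 \<Rightarrow> (rp2 \<Rightarrow> rp2) \<Rightarrow> bool" where
  "represents_projectivity A G \<longleftrightarrow>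
     invertible A \<and> (\<forall>v. v \<noteq> 0 \<longrightarrow> G (proj_pt v) = proj_pt (A *v v))"

text \<open>\<open>G\<close> in the affine chart, at points \<open>x\<close> that \<open>G\<close> does not send to the line at infinity.\<close>

definition affine_expr :: "(rp2 \<Rightarrow> rp2) \<Rightarrow> real^2 \<Rightarrow> real^2" where
  "affine_expr G x = (THE y. aff_pt y = G (aff_pt x))"


section \<open>Spectral notions\<close>

definition complex_matrix :: "real^'n^'m \<Rightarrow> complex^'n^'m" where
  "complex_matrix A = map_matrix complex_of_real A"

definition eigenvector :: "'a::field^'n^'n \<Rightarrow> 'a \<Rightarrow> 'a^'n \<Rightarrow> bool" where
  "eigenvector A z v \<longleftrightarrow> v \<noteq> 0 \<and> A *v v = z *s v"

definition spectrum :: "real^'n^'n \<Rightarrow> complex set" where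
  "spectrum A = {z. \<exists>v. eigenvector (complex_matrix A) z v}"

definition charpoly :: "'a::field^'n^'n \<Rightarrow> 'a poly" where
  "charpoly A = det (mat [:0, 1:] - map_matrix (\<lambda>a. [:a:]) A)"

definition simple_eigenvalue :: "real^'n^'n \<Rightarrow> complex \<Rightarrow> bool" where
  "simple_eigenvalue A z \<longleftrightarrow> z \<in> spectrum A \<and> order z (charpoly (complex_matrix A)) = 1"

text \<open>The real points of the sum of the complex eigenspaces for \<open>z\<close> and its conjugate.\<close>

definition invariant_plane :: "real^3^3 \<Rightarrow> complex \<Rightarrow> (real^3) set" where
  "invariant_plane A z = {x. \<exists>a b.
     complex_matrix A *v a = z *s a \<and> complex_matrix A *v b = cnj z *s b \<and>
     (\<chi> i. complex_of_real (x$i)) = a + b}"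

text \<open>The projection onto \<open>L\<close> along \<open>W\<close>; meaningful for complementary subspaces.\<close>

definition projection_along :: "(real^3) set \<Rightarrow> (real^3) set \<Rightarrow> real^3 \<Rightarrow> real^3" where
  "projection_along L W u = (THE y. y \<in> L \<and> u - y \<in> W)"

definition regular_position :: "real^3^3 \<Rightarrow> real^3 \<Rightarrow> complex \<Rightarrow> real^2 \<Rightarrow> bool" where
  "regular_position A v z p \<longleftrightarrow>
     (\<forall>u. u \<noteq> 0 \<and> proj_pt u = aff_pt p
        \<longrightarrow> projection_along (span {v}) (invariant_plane A z) u \<noteq> 0)"

text \<open>\<open>f\<^sup>q(p) = X + \<tau>\<^sup>q R\<^sup>q x + O(\<tau>\<^sup>2\<^sup>q)\<close>. The power operation on \<^typ>\<open>real^2^2\<close> would be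
  componentwise, hence the iterated action of \<open>R\<close>.\<close>

definition first_order_expansion ::
    "(rp2 \<Rightarrow> rp2) \<Rightarrow> real^2 \<Rightarrow> real \<Rightarrow> real^2^2 \<Rightarrow> real^2 \<Rightarrow> real^2 \<Rightarrow> bool" where
  "first_order_expansion G X \<tau> R p x \<longleftrightarrow>
     (\<lambda>q. norm (affine_expr (G ^^ q) p - (X + \<tau> ^ q *\<^sub>R (((*v) R ^^ q) x)))) \<in> O(\<lambda>q. \<tau> ^ (2 * q))"


section \<open>Quadratic forms on the plane\<close>

definition quadratic_form :: "(real^2 \<Rightarrow> real) \<Rightarrow> bool" where
  "quadratic_form Q \<longleftrightarrow>
     (\<exists>b. bilinear b \<and> (\<forall>x y. b x y = b y x) \<and> (\<forall>x. Q x = b x x))"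

definition pos_def_quadratic_form :: "(real^2 \<Rightarrow> real) \<Rightarrow> bool" where
  "pos_def_quadratic_form Q \<longleftrightarrow> quadratic_form Q \<and> (\<forall>x. x \<noteq> 0 \<longrightarrow> Q x > 0)"

text \<open>The columns of \<open>S\<close> form a \<open>Q\<close>-orthonormal basis, in which \<open>R\<close> has the matrix
  \<open>S\<^sup>-\<^sup>1 R S\<close>.\<close>

definition rotation_for :: "(real^2 \<Rightarrow> real) \<Rightarrow> real^2^2 \<Rightarrow> bool" where
  "rotation_for Q R \<longleftrightarrow>
     (\<exists>S :: real^2^2. invertible S \<and> (\<forall>x. Q (S *v x) = (norm x)\<^sup>2) \<and>
          rotation_matrix (matrix_inv S ** R ** S))"

end

theory Submission
  imports Defs
begin

text \<open>Normalizing by similarities commutes with the pentagram map, so \<open>P\<^sub>k\<close> is \<open>T\<^sup>k(P)\<close> translated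
  to the centroid \<open>C\<^sub>0\<close> and rescaled to area \<open>A\<^sub>0\<close>. The pentagram map also commutes with
  projectivities, so after relabelling \<open>T\<^bsup>qm+r\<^esup>(P)\<close> is \<open>G\<^sup>q(Q\<^sub>r)\<close>. Decomposing a homogeneous lift of a
  vertex \<open>x\<close> of \<open>Q\<^sub>r\<close> as \<open>\<gamma> v + u\<close>, with \<open>v\<close> the lift of \<open>X\<^sub>1\<close> and \<open>u\<close> in the real invariant plane,
  gives \<open>G\<^sup>q(x) = X\<^sub>1 + \<tau>\<^sup>q R\<^sup>q(x - X\<^sub>1)/\<gamma> + O(\<tau>\<^bsup>2q\<^esup>)\<close>, where \<open>R\<close> is conjugate to a rotation because
  it is the action of \<open>G\<close> on that plane seen in the chart. Subtracting the centroid removes \<open>X\<^sub>1\<close>,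
  and area normalization removes \<open>\<tau>\<^sup>q\<close>, since \<open>det R = 1\<close>.\<close>

section \<open>Planar determinants and lines\<close>

lemma det2_eq: "det2 u v = u$1 * v$2 - u$2 * v$1"
  by (simp add: det2_def det_2)

lemma det2_scaleR: "det2 (a *\<^sub>R u) (b *\<^sub>R v) = a * b * det2 u v"
  by (simp add: det2_eq algebra_simps)

lemma det2_eq_0_imp_scaleR:
  assumes "det2 u v = 0" "u \<noteq> 0"
  shows "\<exists>k. v = k *\<^sub>R u"
proof (cases "u$1 = 0")
  case True
  with assms have "u$2 \<noteq> 0"
    by (auto simp: vec_eq_iff forall_2)
  with True assms show ?thesis
    by (intro exI[of _ "v$2 / u$2"]) (auto simp: det2_eq vec_eq_iff forall_2 field_simps)
next
  case False
  with assms show ?thesis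
    by (intro exI[of _ "v$1 / u$1"]) (auto simp: det2_eq vec_eq_iff forall_2 field_simps)
qed

lemma mem_line_through: "x \<in> line_through a b \<longleftrightarrow> (\<exists>t. x = a + t *\<^sub>R (b - a))"
proof
  assume "x \<in> line_through a b"
  then obtain u v where "x = u *\<^sub>R a + v *\<^sub>R b" "u + v = 1"
    by (auto simp: line_through_def affine_hull_2)
  then have "x = (1 - v) *\<^sub>R a + v *\<^sub>R b"
    by (metis add_diff_cancel_right')
  then show "\<exists>t. x = a + t *\<^sub>R (b - a)"
    by (auto simp: algebra_simps)
next
  assume "\<exists>t. x = a + t *\<^sub>R (b - a)"
  then obtain t where "x = (1 - t) *\<^sub>R a + t *\<^sub>R b"
    by (auto simp: algebra_simps)
  moreover have "(1 - t) + t = 1" by simp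
  ultimately show "x \<in> line_through a b"
    unfolding line_through_def affine_hull_2 by blast
qed

text \<open>A translate of a line has the same direction vectors. Conversely, if the directions are
  proportional, translation by \<open>c - a\<close> carries the first line onto the second.\<close>

lemma affine_parallel_line_through_iff:
  assumes "a \<noteq> b" "c \<noteq> d"
  shows "affine_parallel (line_through a b) (line_through c d) \<longleftrightarrow> det2 (b - a) (d - c) = 0"
proof
  assume "affine_parallel (line_through a b) (line_through c d)"
  then obtain k where k: "line_through c d = (\<lambda>x. k + x) ` line_through a b"
    by (auto simp: affine_parallel_def)
  have "c \<in> line_through c d" "d \<in> line_through c d"
    by (auto simp: line_through_def hull_inc)
  then obtain x y where "x \<in> line_through a b" "y \<in> line_through a b" "c = k + x" "d = k + y"
    unfolding k by blast
  then obtain t t' where cd: "c = k + (a + t *\<^sub>R (b - a))" "d = k + (a + t' *\<^sub>R (b - a))"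
    unfolding mem_line_through by blast
  have "d - c = (t' - t) *\<^sub>R (b - a)"
    unfolding cd by (simp add: algebra_simps)
  then show "det2 (b - a) (d - c) = 0"
    by (simp add: det2_eq)
next
  assume "det2 (b - a) (d - c) = 0"
  with assms obtain k where k: "d - c = k *\<^sub>R (b - a)"
    using det2_eq_0_imp_scaleR[of "b - a" "d - c"] by auto
  with assms have "k \<noteq> 0" by auto
  have "x \<in> line_through c d \<longleftrightarrow> x \<in> (\<lambda>x. (c - a) + x) ` line_through a b" for x
  proof
    assume "x \<in> line_through c d"
    then obtain t where "x = c + t *\<^sub>R (d - c)" by (auto simp: mem_line_through)
    with k have "x = (c - a) + (a + (t * k) *\<^sub>R (b - a))" by simp
    then show "x \<in> (\<lambda>x. (c - a) + x) ` line_through a b"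
      using mem_line_through by blast
  next
    assume "x \<in> (\<lambda>x. (c - a) + x) ` line_through a b"
    then obtain y where "y \<in> line_through a b" "x = (c - a) + y" by blast
    then obtain t where "x = (c - a) + (a + t *\<^sub>R (b - a))"
      unfolding mem_line_through by blast
    with k \<open>k \<noteq> 0\<close> have "x = c + (t / k) *\<^sub>R (d - c)" by simp
    then show "x \<in> line_through c d"
      using mem_line_through by blast
  qed
  then show "affine_parallel (line_through a b) (line_through c d)"
    unfolding affine_parallel_def by blast
qed

text \<open>Coinciding endpoints give a zero direction and hence a zero determinant, so one
  nonvanishing condition covers both well-definedness and non-parallelism.\<close>

lemma pentagram_defined_iff:
  "pentagram_defined P \<longleftrightarrow> (\<forall>i. det2 (P (i + 2) - P i) (P (i + 3) - P (i + 1)) \<noteq> 0)"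
proof -
  have "det2 (b - a) (d - c) \<noteq> 0 \<longleftrightarrow>
    a \<noteq> b \<and> c \<noteq> d \<and> \<not> affine_parallel (line_through a b) (line_through c d)" for a b c d
    using affine_parallel_line_through_iff[of a b c d]
    by (cases "a = b \<or> c = d") (auto simp: det2_eq[of 0] det2_eq[of _ 0])
  then show ?thesis
    unfolding pentagram_defined_def by blast
qed

lemma ex1_line_intersection:
  assumes D: "det2 (b - a) (d - c) \<noteq> 0"
  shows "\<exists>!x. x \<in> line_through a b \<inter> line_through c d"
proof (rule ex_ex1I)
  \<comment> \<open>Cramer's rule for \<open>a + t (b - a) = c + u (d - c)\<close>.\<close>
  define t where "t = det2 (c - a) (d - c) / det2 (b - a) (d - c)"
  define u where "u = det2 (c - a) (b - a) / det2 (b - a) (d - c)"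
  have "t * det2 (b - a) (d - c) = det2 (c - a) (d - c)"
    and "u * det2 (b - a) (d - c) = det2 (c - a) (b - a)"
    using D by (simp_all add: t_def u_def)
  then have "(a$1 + t * (b$1 - a$1) - (c$1 + u * (d$1 - c$1))) * det2 (b - a) (d - c) = 0"
    and "(a$2 + t * (b$2 - a$2) - (c$2 + u * (d$2 - c$2))) * det2 (b - a) (d - c) = 0"
    unfolding det2_eq vector_minus_component by algebra+
  then have "a + t *\<^sub>R (b - a) = c + u *\<^sub>R (d - c)"
    using D by (simp add: vec_eq_iff forall_2)
  then show "\<exists>x. x \<in> line_through a b \<inter> line_through c d"
    by (metis IntI mem_line_through)
next
  fix x y
  assume "x \<in> line_through a b \<inter> line_through c d" "y \<in> line_through a b \<inter> line_through c d"
  then obtain t t' u u' where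
    *: "x = a + t *\<^sub>R (b - a)" "x = c + u *\<^sub>R (d - c)" "y = a + t' *\<^sub>R (b - a)" "y = c + u' *\<^sub>R (d - c)"
    unfolding Int_iff mem_line_through by blast
  have "x - y = (t - t') *\<^sub>R (b - a)" unfolding *(1) *(3) by (simp add: algebra_simps)
  moreover have "x - y = (u - u') *\<^sub>R (d - c)" unfolding *(2) *(4) by (simp add: algebra_simps)
  ultimately have "(t - t') *\<^sub>R (b - a) = (u - u') *\<^sub>R (d - c)" by simp
  \<comment> \<open>Pairing with \<open>d - c\<close> kills the right-hand side; the factor 1 brings
    both sides into the shape of \<open>det2_scaleR\<close>.\<close>
  then have "det2 ((t - t') *\<^sub>R (b - a)) (1 *\<^sub>R (d - c)) = det2 ((u - u') *\<^sub>R (d - c)) (1 *\<^sub>R (d - c))"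
    by simp
  then have "(t - t') * det2 (b - a) (d - c) = 0"
    by (simp only: det2_scaleR) (simp add: det2_eq)
  with D have "t = t'" by simp
  with * show "x = y" by simp
qed

lemma pentagram_mem:
  assumes "pentagram_defined P"
  shows "pentagram P i \<in> line_through (P i) (P (i + 2)) \<inter> line_through (P (i + 1)) (P (i + 3))"
  unfolding pentagram_def
  by (rule theI') (use assms ex1_line_intersection pentagram_defined_iff in blast)

lemma pentagram_eqI:
  assumes "pentagram_defined P"
    and "x \<in> line_through (P i) (P (i + 2))" "x \<in> line_through (P (i + 1)) (P (i + 3))"
  shows "pentagram P i = x"
  using assms ex1_line_intersection[of "P (i + 2)" "P i"] pentagram_mem[OF assms(1)]
    pentagram_defined_iff by blast

lemma pentagram_periodic:
  assumes "\<forall>i. P (i + k) = P i"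
  shows "pentagram P (i + k) = pentagram P i"
proof -
  have "P (i + k + 1) = P (i + 1)" "P (i + k + 2) = P (i + 2)" "P (i + k + 3) = P (i + 3)"
    using assms by (metis add.assoc add.commute)+
  then show ?thesis
    using assms by (simp add: pentagram_def)
qed

lemma pentagram_iterate_periodic:
  assumes "\<forall>i. P (i + k) = P i"
  shows "(pentagram ^^ j) P (i + k) = (pentagram ^^ j) P i"
  by (induction j arbitrary: i) (use assms pentagram_periodic in auto)


section \<open>Similarities and the area-normalized map\<close>

text \<open>Scaling and translation carry lines to lines and multiply the determinants of
  \<open>pentagram_defined_iff\<close> by \<open>t * t\<close>, so definedness and intersection
  points are both preserved.\<close>

lemma pentagram_similarity:
  assumes "pentagram_defined P" "t \<noteq> 0"
  shows "pentagram_defined (\<lambda>i. c + t *\<^sub>R P i)"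
    and "pentagram (\<lambda>i. c + t *\<^sub>R P i) = (\<lambda>i. c + t *\<^sub>R pentagram P i)"
proof -
  have "det2 (c + t *\<^sub>R P (i + 2) - (c + t *\<^sub>R P i)) (c + t *\<^sub>R P (i + 3) - (c + t *\<^sub>R P (i + 1)))
      = t * t * det2 (P (i + 2) - P i) (P (i + 3) - P (i + 1))" for i
    by (simp add: det2_eq algebra_simps)
  with assms show defd: "pentagram_defined (\<lambda>i. c + t *\<^sub>R P i)"
    by (simp add: pentagram_defined_iff)
  have line: "c + t *\<^sub>R x \<in> line_through (c + t *\<^sub>R a) (c + t *\<^sub>R b)" if x: "x \<in> line_through a b" for x a b
  proof -
    from x obtain u where u: "x = a + u *\<^sub>R (b - a)" by (auto simp: mem_line_through)
    have "c + t *\<^sub>R x = (c + t *\<^sub>R a) + u *\<^sub>R ((c + t *\<^sub>R b) - (c + t *\<^sub>R a))"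
      unfolding u by (simp add: algebra_simps)
    then show ?thesis using mem_line_through by blast
  qed
  show "pentagram (\<lambda>i. c + t *\<^sub>R P i) = (\<lambda>i. c + t *\<^sub>R pentagram P i)"
    using pentagram_mem[OF assms(1)] by (intro ext pentagram_eqI[OF defd] line) auto
qed

lemma sum_periodic_shift:
  fixes F :: "int \<Rightarrow> 'a::ab_group_add"
  assumes per: "\<And>i. F (i + int n) = F i"
  shows "(\<Sum>i=1..int n. F (i + s)) = (\<Sum>i=1..int n. F i)"
proof -
  have step: "(\<Sum>i=1..int n. F (i + (s + 1))) = (\<Sum>i=1..int n. F (i + s))" for s
  proof -
    \<comment> \<open>The sum telescopes, and its two end terms lie one period apart, so they
      cancel.\<close>
    have "(\<Sum>i=1..int n. F (i + (s + 1)) - F (i + s)) = F (int n + (s + 1)) - F (1 + s)"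
    proof (induction n)
      case (Suc n)
      have "{1..int (Suc n)} = insert (int (Suc n)) {1..int n}" by auto
      then show ?case using Suc by (simp add: algebra_simps)
    qed (simp add: add.commute)
    then show ?thesis
      using per[of "s + 1"] by (simp add: sum_subtractf add.commute add.left_commute)
  qed
  show ?thesis
  proof (induction s rule: int_induct[where k = 0])
    case (step2 i)
    then show ?case using step[of "i - 1"] by simp
  next
    case (step1 i)
    then show ?case using step[of i] by simp
  qed simp
qed

lemma centroid_similarity:
  assumes "n \<ge> 1"
  shows "centroid n (\<lambda>i. c + t *\<^sub>R P i) = c + t *\<^sub>R centroid n P"
  using assms by (simp add: centroid_def sum.distrib scaleR_right.sum[symmetric]
      scaleR_add_right del: sum_constant) (simp add: sum_constant_scaleR del: sum_constant)

lemma centroid_relabel: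
  assumes "\<And>i. P (i + int n) = P i"
  shows "centroid n (\<lambda>i. P (i + s)) = centroid n P"
  using sum_periodic_shift[of P n s] assms by (simp add: centroid_def)

lemma area_relabel:
  assumes "\<And>i. P (i + int n) = P i"
  shows "area n (\<lambda>i. P (i + s)) = area n P"
proof -
  have "P (i + int n + 1) = P (i + 1)" for i
    using assms[of "i + 1"] by (simp add: add_ac)
  then show ?thesis
    using sum_periodic_shift[of "\<lambda>i. det2 (P i) (P (i + 1))" n s] assms
    by (simp add: area_def add_ac)
qed

text \<open>The translation contributes only differences of consecutive values of
  \<open>det2 c (P i)\<close>, which cancel around the closed polygon.\<close>

lemma area_similarity:
  assumes per: "\<And>i. P (i + int n) = P i"
  shows "area n (\<lambda>i. c + t *\<^sub>R P i) = t\<^sup>2 * area n P"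
proof -
  have "(\<Sum>i=1..int n. det2 (c + t *\<^sub>R P i) (c + t *\<^sub>R P (i + 1)))
      = (\<Sum>i=1..int n. t\<^sup>2 * det2 (P i) (P (i + 1)) + (t * det2 c (P (i + 1)) - t * det2 c (P i)))"
    by (intro sum.cong refl) (simp add: det2_eq algebra_simps power2_eq_square)
  also have "\<dots> = t\<^sup>2 * (\<Sum>i=1..int n. det2 (P i) (P (i + 1)))"
    using sum_periodic_shift[of "\<lambda>i. t * det2 c (P i)" n 1] per
    by (simp add: sum.distrib sum_subtractf sum_distrib_left)
  finally show ?thesis
    by (simp add: area_def abs_mult)
qed

text \<open>Every iterate of the normalized map is a similar copy \<open>?N k\<close> of T^k(P) with
  the original centroid and area. By similarity invariance, one more step again yields such a
  copy.\<close>

lemma normalized_pentagram_iterate: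
  assumes poly: "polygon n P"
    and it: "\<forall>k. pentagram_defined ((pentagram ^^ k) P) \<and> area n ((pentagram ^^ k) P) \<noteq> 0"
  shows "(normalized_pentagram n ^^ k) P = (\<lambda>i. centroid n P +
      sqrt (area n P / area n ((pentagram ^^ k) P)) *\<^sub>R
        ((pentagram ^^ k) P i - centroid n ((pentagram ^^ k) P)))"
    and "normalized_pentagram_defined n ((normalized_pentagram n ^^ k) P)"
proof -
  define A where "A = area n P"
  define T where "T k = (pentagram ^^ k) P" for k
  define t where "t k = sqrt (A / area n (T k))" for k
  define c where "c k = centroid n P - t k *\<^sub>R centroid n (T k)" for k
  have n: "n \<ge> 1" and per: "\<And>k i. T k (i + int n) = T k i"
    using poly pentagram_iterate_periodic by (auto simp: polygon_def T_def)
  have Apos: "area n (T k) > 0" for k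
    using it by (auto simp: T_def area_def)
  have A0: "A > 0" using Apos[of 0] by (simp add: A_def T_def)
  have tpos: "t k > 0" for k using A0 Apos by (simp add: t_def)
  have t2: "(t k)\<^sup>2 * area n (T k) = A" for k
    using A0 Apos[of k] by (simp add: t_def)
  have defd: "pentagram_defined (T k)" for k using it by (simp add: T_def)
  have TS: "pentagram (T k) = T (Suc k)" for k by (simp add: T_def)
  let ?N = "\<lambda>k i. c k + t k *\<^sub>R T k i"
  have pN: "pentagram_defined (?N k)" "pentagram (?N k) = (\<lambda>i. c k + t k *\<^sub>R T (Suc k) i)" for k
    using pentagram_similarity[OF defd[of k], of "t k" "c k"] tpos[of k] by (auto simp: TS)
  have aN: "area n (?N k) = A" for k
    by (simp add: area_similarity per t2)
  have aN': "area n (\<lambda>i. c k + t k *\<^sub>R T (Suc k) i) = (t k)\<^sup>2 * area n (T (Suc k))" for k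
    by (simp add: area_similarity per)
  have cN: "centroid n (?N k) = centroid n P" for k
    using n by (simp add: centroid_similarity c_def)
  have step: "normalized_pentagram n (?N k) = ?N (Suc k)" for k
  proof -
    \<comment> \<open>The factor applied in one step is the ratio of consecutive total factors, so
      the product of all steps telescopes to \<open>t k\<close>.\<close>
    have "sqrt (A / ((t k)\<^sup>2 * area n (T (Suc k)))) = t (Suc k) / t k"
      using tpos[of k] unfolding t_def[of "Suc k"] by (simp add: real_sqrt_divide real_sqrt_mult)
    then show ?thesis
      unfolding normalized_pentagram_def pN aN aN' cN centroid_similarity[OF n]
      using tpos[of k] by (simp add: c_def algebra_simps)
  qed
  have main: "(normalized_pentagram n ^^ k) P = ?N k" for k
  proof (induction k)
    case 0
    have "t 0 = 1" using A0 by (simp add: t_def T_def A_def)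
    then show ?case by (simp add: c_def T_def)
  qed (simp add: step)
  then show "(normalized_pentagram n ^^ k) P = (\<lambda>i. centroid n P +
      sqrt (area n P / area n ((pentagram ^^ k) P)) *\<^sub>R
        ((pentagram ^^ k) P i - centroid n ((pentagram ^^ k) P)))"
    by (simp add: c_def t_def T_def A_def algebra_simps)
  show "normalized_pentagram_defined n ((normalized_pentagram n ^^ k) P)"
    unfolding main normalized_pentagram_defined_def aN pN aN'
    using pN A0 tpos[of k] Apos[of "Suc k"] by auto
qed


section \<open>Projectivities in the affine chart\<close>

definition homog :: "real^2 \<Rightarrow> real^3" where
  "homog x = vector [x$1, x$2, 1]"

definition fst2 :: "real^3 \<Rightarrow> real^2" where
  "fst2 y = vector [y$1, y$2]"

lemma homog_nth [simp]: "homog x $ 1 = x$1" "homog x $ 2 = x$2" "homog x $ 3 = 1"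
  by (simp_all add: homog_def)

lemma fst2_nth [simp]: "fst2 y $ 1 = y$1" "fst2 y $ 2 = y$2"
  by (simp_all add: fst2_def)

lemma homog_nonzero [simp]: "homog x \<noteq> 0"
  by (metis homog_nth(3) zero_index zero_neq_one)

lemma aff_pt_homog: "aff_pt x = proj_pt (homog x)"
  by (simp add: aff_pt_def homog_def)

text \<open>Spans of nonzero vectors lie in the carrier of \<open>rp2\<close>, where
  \<open>Abs_rp2\<close> is injective; equal spans have proportional generators.\<close>

lemma proj_pt_eq_iff:
  assumes "u \<noteq> 0" "v \<noteq> 0"
  shows "proj_pt u = proj_pt v \<longleftrightarrow> (\<exists>c. c \<noteq> 0 \<and> u = c *\<^sub>R v)"
proof -
  have "proj_pt u = proj_pt v \<longleftrightarrow> span {u} = span {v}"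
    unfolding proj_pt_def using assms by (intro Abs_rp2_inject) auto
  also have "\<dots> \<longleftrightarrow> (\<exists>c. c \<noteq> 0 \<and> u = c *\<^sub>R v)"
  proof
    assume "span {u} = span {v}"
    then have "u \<in> span {v}" using span_base by blast
    with assms show "\<exists>c. c \<noteq> 0 \<and> u = c *\<^sub>R v" by (auto simp: span_singleton)
  next
    assume "\<exists>c. c \<noteq> 0 \<and> u = c *\<^sub>R v"
    then obtain c where "c \<noteq> 0" "u = c *\<^sub>R v" by blast
    then show "span {u} = span {v}"
      using span_image_scale[of "{v}" "\<lambda>_. c"] by simp
  qed
  finally show ?thesis .
qed

lemma aff_pt_inject [simp]: "aff_pt x = aff_pt y \<longleftrightarrow> x = y"
proof
  assume "aff_pt x = aff_pt y"
  then obtain c where "homog x = c *\<^sub>R homog y"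
    by (auto simp: aff_pt_homog proj_pt_eq_iff)
  then show "x = y"
    by (simp add: vec_eq_iff forall_2 forall_3)
qed simp

lemma proj_pt_affine:
  assumes "y$3 \<noteq> 0"
  shows "proj_pt y = aff_pt ((1 / y$3) *\<^sub>R fst2 y)"
proof -
  have "y = y$3 *\<^sub>R homog ((1 / y$3) *\<^sub>R fst2 y)"
    using assms by (simp add: vec_eq_iff forall_3)
  moreover have "y \<noteq> 0" using assms by auto
  ultimately show ?thesis
    using assms unfolding aff_pt_homog by (subst proj_pt_eq_iff) (auto intro!: exI[of _ "y$3"])
qed

lemma affine_expr_eqI: "aff_pt y = G (aff_pt x) \<Longrightarrow> affine_expr G x = y"
  unfolding affine_expr_def by (rule the_equality) (auto simp flip: aff_pt_inject)

lemma affine_expr_proj_pt: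
  assumes "G (aff_pt x) = proj_pt y" "y$3 \<noteq> 0"
  shows "affine_expr G x = (1 / y$3) *\<^sub>R fst2 y"
  using assms proj_pt_affine by (intro affine_expr_eqI) simp

lemma invertible_mult_nonzero:
  fixes A :: "real^'n^'n"
  assumes "invertible A" "v \<noteq> 0"
  shows "A *v v \<noteq> 0"
  using assms by (metis invertible_def matrix_left_invertible_ker)

lemma homog_line:
  "homog (a + t *\<^sub>R (b - a)) = (1 - t) *\<^sub>R homog a + t *\<^sub>R homog b"
  by (simp add: vec_eq_iff forall_3 algebra_simps)

text \<open>The lifts have third coordinate 1, so \<open>\<alpha> + \<beta> = y$3\<close> and
  division by \<open>y$3\<close> makes the combination affine.\<close>

lemma mem_line_through_homog:
  assumes "y = \<alpha> *\<^sub>R homog a + \<beta> *\<^sub>R homog b" "y$3 \<noteq> 0"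
  shows "(1 / y$3) *\<^sub>R fst2 y \<in> line_through a b"
proof -
  have \<alpha>: "\<alpha> = y$3 - \<beta>" using assms by simp
  have "fst2 y = y$3 *\<^sub>R a + \<beta> *\<^sub>R (b - a)"
    using assms(1) unfolding \<alpha> by (simp add: vec_eq_iff forall_2 forall_3 algebra_simps)
  then have "(1 / y$3) *\<^sub>R fst2 y = a + (\<beta> / y$3) *\<^sub>R (b - a)"
    using assms(2) by (simp add: scaleR_add_right)
  then show ?thesis using mem_line_through by blast
qed

text \<open>The matrix carries the plane over each diagonal of \<open>P\<close> to the plane over
  the corresponding diagonal of \<open>P'\<close>. The image of the intersection point therefore
  lies on both image diagonals, once it is known to be finite.\<close>

lemma pentagram_projectivity:
  assumes G: "represents_projectivity A G"
    and P: "pentagram_defined P" and P': "pentagram_defined P'"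
    and eq: "\<And>i. aff_pt (P' i) = G (aff_pt (P i))"
  shows "aff_pt (pentagram P' i) = G (aff_pt (pentagram P i))"
proof -
  have inv: "invertible A" and Gv: "\<And>v. v \<noteq> 0 \<Longrightarrow> G (proj_pt v) = proj_pt (A *v v)"
    using G by (auto simp: represents_projectivity_def)
  have "\<exists>c. c \<noteq> 0 \<and> A *v homog (P i) = c *\<^sub>R homog (P' i)" for i
  proof -
    have "proj_pt (A *v homog (P i)) = proj_pt (homog (P' i))"
      using eq[of i] Gv[of "homog (P i)"] by (simp add: aff_pt_homog)
    then show ?thesis
      using invertible_mult_nonzero[OF inv] by (subst (asm) proj_pt_eq_iff) auto
  qed
  then obtain c where c: "\<And>i. A *v homog (P i) = c i *\<^sub>R homog (P' i)"
    by metis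
  define x where "x = pentagram P i"
  define y where "y = A *v homog x"
  obtain t where "x = P i + t *\<^sub>R (P (i + 2) - P i)"
    using pentagram_mem[OF P, of i] by (auto simp: x_def mem_line_through)
  then obtain \<alpha> \<beta> where y1: "y = \<alpha> *\<^sub>R homog (P' i) + \<beta> *\<^sub>R homog (P' (i + 2))"
    using that[of "(1 - t) * c i" "t * c (i + 2)"]
    by (simp add: y_def homog_line matrix_vector_right_distrib matrix_vector_mult_scaleR c)
  obtain u where "x = P (i + 1) + u *\<^sub>R (P (i + 3) - P (i + 1))"
    using pentagram_mem[OF P, of i] by (auto simp: x_def mem_line_through)
  then obtain \<gamma> \<delta> where y2: "y = \<gamma> *\<^sub>R homog (P' (i + 1)) + \<delta> *\<^sub>R homog (P' (i + 3))"
    using that[of "(1 - u) * c (i + 1)" "u * c (i + 3)"]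
    by (simp add: y_def homog_line matrix_vector_right_distrib matrix_vector_mult_scaleR c)
  have y0: "y \<noteq> 0"
    using inv by (simp add: y_def invertible_mult_nonzero)
  \<comment> \<open>A point at infinity on both diagonals of \<open>P'\<close> would be a common
    direction, contradicting their non-parallelism.\<close>
  have y3: "y$3 \<noteq> 0"
  proof
    assume y3: "y$3 = 0"
    have *: "\<alpha> = - \<beta>" using y3 unfolding y1 by (simp add: eq_neg_iff_add_eq_0)
    have **: "\<gamma> = - \<delta>" using y3 unfolding y2 by (simp add: eq_neg_iff_add_eq_0)
    have "fst2 y = \<beta> *\<^sub>R (P' (i + 2) - P' i)" unfolding y1 *
      by (simp add: vec_eq_iff forall_2 algebra_simps)
    moreover have "fst2 y = \<delta> *\<^sub>R (P' (i + 3) - P' (i + 1))" unfolding y2 **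
      by (simp add: vec_eq_iff forall_2 algebra_simps)
    ultimately have e: "\<beta> *\<^sub>R (P' (i + 2) - P' i) = \<delta> *\<^sub>R (P' (i + 3) - P' (i + 1))" by simp
    have "det2 (\<beta> *\<^sub>R (P' (i + 2) - P' i)) (1 *\<^sub>R (P' (i + 3) - P' (i + 1))) = 0"
      unfolding e by (simp only: det2_scaleR) (simp add: det2_eq)
    then have "\<beta> = 0"
      using P' by (simp only: det2_scaleR) (simp add: pentagram_defined_iff)
    with y1 * y0 show False by simp
  qed
  have "pentagram P' i = (1 / y$3) *\<^sub>R fst2 y"
    by (intro pentagram_eqI[OF P'] mem_line_through_homog[OF y1 y3] mem_line_through_homog[OF y2 y3])
  moreover have "G (aff_pt x) = proj_pt y"
    by (simp add: aff_pt_homog Gv y_def)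
  ultimately show ?thesis
    using proj_pt_affine[OF y3] by (simp add: x_def)
qed

text \<open>Projective naturality of the pentagram map propagates the self-similarity from \<open>P\<close> to all
  its iterates.\<close>

lemma pentagram_projective_period:
  assumes G: "represents_projectivity A G"
    and per: "aff_pt \<circ> (pentagram ^^ m) P = relabel s (G \<circ> (aff_pt \<circ> P))"
    and it: "\<forall>k. pentagram_defined ((pentagram ^^ k) P)"
  shows "(G ^^ q) (aff_pt ((pentagram ^^ r) P i)) =
    aff_pt ((pentagram ^^ (q * m + r)) P (i - int q * s))"
proof -
  \<comment> \<open>Undoing the relabelling shifts the index by \<open>- s\<close> in each period,
    whence the total shift \<open>- int q * s\<close>.\<close>
  have one: "aff_pt ((pentagram ^^ (m + k)) P (i - s)) = G (aff_pt ((pentagram ^^ k) P i))" for k i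
  proof (induction k arbitrary: i)
    case 0
    show ?case using fun_cong[OF per, of "i - s"] by (simp add: relabel_def)
  next
    case (Suc k)
    let ?P' = "\<lambda>i. (pentagram ^^ (m + k)) P (i - s)"
    have sh: "pentagram ?P' i = pentagram ((pentagram ^^ (m + k)) P) (i - s)" for i
      by (simp add: pentagram_def algebra_simps)
    have "pentagram_defined ?P'"
      using it[THEN spec, of "m + k", unfolded pentagram_defined_iff, THEN spec, of "i - s" for i]
      unfolding pentagram_defined_iff by (simp add: algebra_simps)
    then have "aff_pt (pentagram ?P' i) = G (aff_pt (pentagram ((pentagram ^^ k) P) i))"
      using it Suc by (intro pentagram_projectivity[OF G]) auto
    then show ?case by (simp add: sh)
  qed
  show ?thesis
  proof (induction q)
    case (Suc q)
    show ?case
      using one[of "q * m + r" "i - int q * s"] Suc by (simp add: algebra_simps)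
  qed simp
qed


section \<open>Real invariant planes of non-real eigenvalues\<close>

lemma complex_matrix_mult_Re_Im:
  "Re ((complex_matrix A *v a)$i) = (A *v (\<chi> j. Re (a$j)))$i"
  "Im ((complex_matrix A *v a)$i) = (A *v (\<chi> j. Im (a$j)))$i"
  by (simp_all add: complex_matrix_def map_matrix_def matrix_vector_mult_def)

lemma complex_matrix_mult_of_real:
  "complex_matrix A *v (\<chi> j. complex_of_real (x$j)) = (\<chi> j. complex_of_real ((A *v x)$j))"
  by (simp add: complex_matrix_def map_matrix_def matrix_vector_mult_def)

lemma complex_matrix_mult_cnj:
  "complex_matrix A *v (\<chi> j. cnj (a$j)) = (\<chi> j. cnj ((complex_matrix A *v a)$j))"
  by (simp add: complex_matrix_def map_matrix_def matrix_vector_mult_def)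

lemma eigenvector_Re_Im:
  assumes "complex_matrix A *v a = z *s a"
  shows "A *v (\<chi> j. Re (a$j)) = Re z *\<^sub>R (\<chi> j. Re (a$j)) - Im z *\<^sub>R (\<chi> j. Im (a$j))"
    and "A *v (\<chi> j. Im (a$j)) = Im z *\<^sub>R (\<chi> j. Re (a$j)) + Re z *\<^sub>R (\<chi> j. Im (a$j))"
  using complex_matrix_mult_Re_Im[of A a, symmetric] unfolding assms
  by (simp_all add: vec_eq_iff algebra_simps)

lemma real_combination_in_invariant_plane:
  assumes e: "complex_matrix A *v e = z *s e"
  shows "\<alpha> *\<^sub>R (\<chi> j. Re (e$j)) + \<beta> *\<^sub>R (\<chi> j. Im (e$j)) \<in> invariant_plane A z"
proof -
  \<comment> \<open>The vectors \<open>a\<close> and \<open>b\<close> are conjugate, and twice the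
    real part of \<open>a\<close> is the given combination of the real and imaginary parts of
    \<open>e\<close>.\<close>
  define a where "a = (Complex \<alpha> (- \<beta>) / 2) *s e"
  define b where "b = (Complex \<alpha> \<beta> / 2) *s (\<chi> j. cnj (e$j))"
  have cnj: "complex_matrix A *v (\<chi> j. cnj (e$j)) = cnj z *s (\<chi> j. cnj (e$j))"
    unfolding complex_matrix_mult_cnj e by (simp add: vec_eq_iff)
  have "complex_matrix A *v a = z *s a" "complex_matrix A *v b = cnj z *s b"
    by (simp_all add: a_def b_def vector_scalar_commute e cnj mult.commute)
  moreover have "(\<chi> i. complex_of_real ((\<alpha> *\<^sub>R (\<chi> j. Re (e$j)) + \<beta> *\<^sub>R (\<chi> j. Im (e$j)))$i)) = a + b"
    by (auto simp: a_def b_def vec_eq_iff complex_eq_iff field_simps)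
  ultimately show ?thesis
    unfolding invariant_plane_def by blast
qed

text \<open>The real quadratic factor of the characteristic polynomial annihilates the plane; this is
  what separates it from any real eigenline.\<close>

lemma invariant_plane_annihilated:
  assumes "x \<in> invariant_plane A z"
  shows "A *v (A *v x) - (2 * Re z) *\<^sub>R (A *v x) + (cmod z)\<^sup>2 *\<^sub>R x = 0"
proof -
  from assms obtain a b where a: "complex_matrix A *v a = z *s a"
    and b: "complex_matrix A *v b = cnj z *s b"
    and x: "(\<chi> i. complex_of_real (x$i)) = a + b"
    unfolding invariant_plane_def by blast
  have x1: "(\<chi> i. complex_of_real ((A *v x)$i)) = z *s a + cnj z *s b"
    unfolding complex_matrix_mult_of_real[symmetric] x matrix_vector_right_distrib a b ..
  have x2: "(\<chi> i. complex_of_real ((A *v (A *v x))$i)) = (z * z) *s a + (cnj z * cnj z) *s b"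
    unfolding complex_matrix_mult_of_real[symmetric, of A "A *v x"] x1 matrix_vector_right_distrib
      vector_scalar_commute a b vector_smult_assoc ..
  have "complex_of_real ((A *v (A *v x) - (2 * Re z) *\<^sub>R (A *v x) + (cmod z)\<^sup>2 *\<^sub>R x)$i) = 0" for i
  proof -
    have *: "complex_of_real (x$i) = a$i + b$i"
      "complex_of_real ((A *v x)$i) = z * a$i + cnj z * b$i"
      "complex_of_real ((A *v (A *v x))$i) = z * z * a$i + cnj z * cnj z * b$i"
      using x x1 x2 by (simp_all add: vec_eq_iff)
    have split: "complex_of_real ((u - r *\<^sub>R v + t *\<^sub>R x)$i) =
        complex_of_real (u$i) - complex_of_real r * complex_of_real (v$i) + complex_of_real t * complex_of_real (x$i)"
      for u v :: "real^3" and r t by simp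
    \<comment> \<open>The coefficients are the sum and product of \<open>z\<close> and its
      conjugate, which are thus the roots of the quadratic.\<close>
    have **: "complex_of_real (2 * Re z) = z + cnj z" "complex_of_real ((cmod z)\<^sup>2) = z * cnj z"
      by (simp add: complex_add_cnj) (rule complex_norm_square)
    then show ?thesis
      unfolding split * ** by (simp add: algebra_simps)
  qed
  then show ?thesis
    by (metis of_real_eq_0_iff vec_eq_iff zero_index)
qed

text \<open>On a real eigenvector the quadratic acts as the scalar (lam - Re z)^2 + (Im z)^2, which
  is positive for non-real \<open>z\<close>. Hence a real eigenline meets the invariant plane only
  in 0.\<close>

lemma eigenvector_annihilated_eq_0:
  fixes A :: "real^'n^'n"
  assumes "A *v x = lam *\<^sub>R x" "Im z \<noteq> 0"
    and "A *v (A *v x) - (2 * Re z) *\<^sub>R (A *v x) + (cmod z)\<^sup>2 *\<^sub>R x = 0"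
  shows "x = 0"
proof -
  have "(lam\<^sup>2 - 2 * Re z * lam + (cmod z)\<^sup>2) *\<^sub>R x = 0"
    using assms(1,3) by (simp add: matrix_vector_mult_scaleR algebra_simps power2_eq_square)
  moreover have "lam\<^sup>2 - 2 * Re z * lam + (cmod z)\<^sup>2 = (lam - Re z)\<^sup>2 + (Im z)\<^sup>2"
    unfolding cmod_power2 by (simp add: power2_eq_square algebra_simps)
  moreover have "(lam - Re z)\<^sup>2 + (Im z)\<^sup>2 \<noteq> 0"
    using assms(2) by simp
  ultimately show ?thesis using assms(2) by auto
qed

lemma regular_position_not_in_invariant_plane:
  assumes "regular_position A v z p" "A *v v = lam *\<^sub>R v" "Im z \<noteq> 0"
  shows "homog p \<notin> invariant_plane A z"
proof
  let ?W = "invariant_plane A z"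
  assume W: "homog p \<in> ?W"
  \<comment> \<open>This uniqueness evaluates the definite description in
    \<open>projection_along\<close>: \<open>y\<close> is a difference of two annihilated vectors,
    hence an annihilated eigenvector or 0.\<close>
  have "y = 0" if y: "y \<in> span {v}" "homog p - y \<in> ?W" for y
  proof -
    from y obtain k where "y = k *\<^sub>R v" by (auto simp: span_singleton)
    then have ev: "A *v y = lam *\<^sub>R y"
      using assms(2) by (simp add: matrix_vector_mult_scaleR)
    let ?E = "\<lambda>x. A *v (A *v x) - (2 * Re z) *\<^sub>R (A *v x) + (cmod z)\<^sup>2 *\<^sub>R x"
    have "?E (homog p - (homog p - y)) = ?E (homog p) - ?E (homog p - y)"
      by (simp add: matrix_vector_mult_diff_distrib algebra_simps)
    then have "?E y = 0"
      using invariant_plane_annihilated[OF W] invariant_plane_annihilated[OF y(2)] by simp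
    then show ?thesis using eigenvector_annihilated_eq_0[OF ev assms(3)] by simp
  qed
  then have "projection_along (span {v}) ?W (homog p) = 0"
    unfolding projection_along_def using W by (intro the_equality) (auto simp: span_zero)
  then show False
    using assms(1) homog_nonzero unfolding regular_position_def aff_pt_homog by blast
qed


section \<open>The spectral frame in the affine chart\<close>

text \<open>Rotation by \<open>- \<phi>\<close>: multiplication by \<open>cis \<phi>\<close> on an
  eigenvector, seen in coordinates with respect to its real and imaginary parts.\<close>

definition rot2 :: "real \<Rightarrow> real^2^2" where
  "rot2 \<phi> = vector [vector [cos \<phi>, sin \<phi>], vector [- sin \<phi>, cos \<phi>]]"

text \<open>The projection of \<open>\<real>\<^sup>3\<close> onto the chart plane along \<open>homog X\<close>.\<close>

definition chart_part :: "real^2 \<Rightarrow> real^3 \<Rightarrow> real^2" where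
  "chart_part X y = fst2 y - y$3 *\<^sub>R X"

lemma chart_part_add: "chart_part X (y + y') = chart_part X y + chart_part X y'"
  and chart_part_scaleR: "chart_part X (c *\<^sub>R y) = c *\<^sub>R chart_part X y"
  and chart_part_homog: "chart_part X (homog x) = x - X"
  by (simp_all add: chart_part_def vec_eq_iff forall_2 algebra_simps)

lemma chart_part_eq_0: "chart_part X y = 0 \<Longrightarrow> y = y$3 *\<^sub>R homog X"
  by (simp add: chart_part_def vec_eq_iff forall_2 forall_3)

lemma rot2_mult: "rot2 \<phi> *v c = vector [cos \<phi> * c$1 + sin \<phi> * c$2, - sin \<phi> * c$1 + cos \<phi> * c$2]"
  by (simp add: rot2_def vec_eq_iff forall_2 matrix_vector_mult_def sum_2)

lemma rotation_matrix_rot2: "rotation_matrix (rot2 \<phi>)"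
  unfolding rotation_matrix_def orthogonal_matrix_def
  by (simp add: rot2_def vec_eq_iff forall_2 matrix_matrix_mult_def sum_2 transpose_def mat_def
      det_2 power2_eq_square[symmetric] algebra_simps)

text \<open>The real and imaginary parts of an eigenvector parametrize the invariant plane by
  \<open>L\<close>, and \<open>S\<close> shows this parametrization in the chart. \<open>S\<close>
  is injective because the plane meets the eigenline of \<open>homog X\<close> only in 0.\<close>

lemma spectral_frame_exists:
  assumes z: "z \<in> spectrum A" "Im z \<noteq> 0"
    and X: "A *v homog X = lam *\<^sub>R homog X"
    and \<phi>: "z = complex_of_real (lam * \<tau>) * cis \<phi>"
  obtains L S where "linear L" "invertible S" "\<And>c. S *v c = chart_part X (L c)"
    "\<And>c. A *v L c = (lam * \<tau>) *\<^sub>R L (rot2 \<phi> *v c)" "\<And>c. L c \<in> invariant_plane A z"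
proof -
  from z obtain e where e0: "e \<noteq> 0" and e: "complex_matrix A *v e = z *s e"
    by (auto simp: spectrum_def eigenvector_def)
  define p where "p = (\<chi> j. Re (e$j))"
  define q where "q = (\<chi> j. Im (e$j))"
  have Ap: "A *v p = Re z *\<^sub>R p - Im z *\<^sub>R q" and Aq: "A *v q = Im z *\<^sub>R p + Re z *\<^sub>R q"
    using eigenvector_Re_Im[OF e] by (simp_all add: p_def q_def)
  define L where "L c = c$1 *\<^sub>R p + c$2 *\<^sub>R q" for c :: "real^2"
  define S :: "real^2^2" where "S = matrix (\<lambda>c. chart_part X (L c))"
  have linL: "linear L"
    by (rule linearI) (simp_all add: L_def algebra_simps)
  have "linear (\<lambda>c. chart_part X (L c))"
    by (rule linearI) (simp_all add: linear_add[OF linL] linear_scale[OF linL]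
        chart_part_add chart_part_scaleR)
  then have S: "S *v c = chart_part X (L c)" for c
    by (simp add: S_def)
  have W: "L c \<in> invariant_plane A z" for c
    using real_combination_in_invariant_plane[OF e] by (simp add: L_def p_def q_def)
  have AL: "A *v L c = (Re z * c$1 + Im z * c$2) *\<^sub>R p + (Re z * c$2 - Im z * c$1) *\<^sub>R q" for c
    by (simp add: L_def matrix_vector_right_distrib matrix_vector_mult_scaleR Ap Aq algebra_simps)
  have "c = 0" if "S *v c = 0" for c
  proof -
    have "L c = (L c)$3 *\<^sub>R homog X"
      using that S chart_part_eq_0 by metis
    then have "A *v L c = lam *\<^sub>R L c"
      using X by (metis matrix_vector_mult_scaleR scaleR_left_commute)
    then have Lc: "L c = 0"
      using eigenvector_annihilated_eq_0 invariant_plane_annihilated W z(2) by blast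
    \<comment> \<open>Applying \<open>A\<close> to \<open>L c = 0\<close> gives a second linear
      relation between \<open>p\<close> and \<open>q\<close>. The two relations have determinant of
      absolute value \<open>(c$1)\<^sup>2 + (c$2)\<^sup>2\<close>, so \<open>p = q = 0\<close>
      unless \<open>c = 0\<close>.\<close>
    have "A *v L c - Re z *\<^sub>R L c = Im z *\<^sub>R (c$2 *\<^sub>R p - c$1 *\<^sub>R q)"
      by (simp add: AL) (simp add: L_def algebra_simps)
    with Lc z(2) have c2: "c$2 *\<^sub>R p = c$1 *\<^sub>R q" by simp
    have c1: "c$1 *\<^sub>R p = - (c$2 *\<^sub>R q)"
      using Lc by (simp add: L_def eq_neg_iff_add_eq_0)
    have "((c$1)\<^sup>2 + (c$2)\<^sup>2) *\<^sub>R p = c$1 *\<^sub>R (c$1 *\<^sub>R p) + c$2 *\<^sub>R (c$2 *\<^sub>R p)"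
      by (simp add: algebra_simps power2_eq_square)
    also have "\<dots> = 0" unfolding c1 c2 by simp
    finally have p: "(c$1)\<^sup>2 + (c$2)\<^sup>2 = 0 \<or> p = 0" by simp
    have "((c$1)\<^sup>2 + (c$2)\<^sup>2) *\<^sub>R q = c$1 *\<^sub>R (c$1 *\<^sub>R q) + c$2 *\<^sub>R (c$2 *\<^sub>R q)"
      by (simp add: algebra_simps power2_eq_square)
    also have "\<dots> = c$2 *\<^sub>R (c$1 *\<^sub>R p + c$2 *\<^sub>R q)"
      unfolding c2[symmetric] by (simp add: algebra_simps)
    also have "\<dots> = 0" unfolding c1 by simp
    finally have q: "(c$1)\<^sup>2 + (c$2)\<^sup>2 = 0 \<or> q = 0" by simp
    have "\<not> (p = 0 \<and> q = 0)"
      using e0 by (auto simp: p_def q_def vec_eq_iff complex_eq_iff)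
    with p q show "c = 0"
      by (auto simp: vec_eq_iff forall_2)
  qed
  then have "invertible S"
    by (simp add: invertible_left_inverse matrix_left_invertible_ker)
  moreover have "A *v L c = (lam * \<tau>) *\<^sub>R L (rot2 \<phi> *v c)" for c
  proof -
    have "Re z = lam * \<tau> * cos \<phi>" "Im z = lam * \<tau> * sin \<phi>"
      by (simp_all add: \<phi>)
    then show ?thesis
      unfolding AL by (simp add: L_def rot2_mult algebra_simps)
  qed
  ultimately show ?thesis
    using that linL S W by blast
qed

text \<open>The third coordinate \<open>g\<close> of the image lift equals \<open>lam\<close> at
  \<open>X\<close>, so it is nonzero nearby. Dehomogenizing there gives X + K(x - X)/g(x), which can
  be differentiated directly.\<close>

lemma affine_expr_near_fixed_point:
  assumes G: "represents_projectivity A G" and X: "A *v homog X = lam *\<^sub>R homog X" and lam: "lam \<noteq> 0"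
  shows "\<forall>\<^sub>F x in nhds X. aff_pt (affine_expr G x) = G (aff_pt x)"
    and "(affine_expr G has_derivative
      (\<lambda>h. (1 / lam) *\<^sub>R chart_part X (A *v (homog h - homog 0)))) (at X)"
proof -
  \<comment> \<open>Subtracting \<open>homog 0\<close> leaves the linear part of the affine map
    \<open>homog\<close>.\<close>
  define K where "K h = chart_part X (A *v (homog h - homog 0))" for h
  define g where "g x = (A *v homog x)$3" for x
  have K: "linear K"
  proof (rule linearI)
    fix x y :: "real^2" and c :: real
    have add: "homog (x + y) - homog 0 = (homog x - homog 0) + (homog y - homog 0)"
      and scale: "homog (c *\<^sub>R x) - homog 0 = c *\<^sub>R (homog x - homog 0)"
      by (simp_all add: vec_eq_iff forall_3)
    show "K (x + y) = K x + K y" "K (c *\<^sub>R x) = c *\<^sub>R K x"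
      unfolding K_def add scale matrix_vector_right_distrib matrix_vector_mult_scaleR
        chart_part_add chart_part_scaleR by (rule refl)+
  qed
  have g_eq: "g x = A$3$1 * x$1 + A$3$2 * x$2 + A$3$3" for x
    by (simp add: g_def matrix_vector_mult_def sum_3)
  have gd: "(g has_derivative (\<lambda>h. A$3$1 * h$1 + A$3$2 * h$2)) (at x)" for x
    unfolding g_eq
    by (auto intro!: derivative_eq_intros bounded_linear_imp_has_derivative bounded_linear_vec_nth)
  have gX: "g X = lam" by (simp add: g_def X)
  have Gx: "G (aff_pt x) = proj_pt (A *v homog x)" for x
    using G by (simp add: represents_projectivity_def aff_pt_homog)
  have "isCont g X" using gd has_derivative_continuous by blast
  then have "(g \<longlongrightarrow> lam) (nhds X)"
    using tendsto_at_iff_tendsto_nhds[of g X] gX by (simp add: isCont_def)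
  then have "\<forall>\<^sub>F x in nhds X. g x \<noteq> 0"
    using lam by (rule tendsto_imp_eventually_ne)
  then have ev: "\<forall>\<^sub>F x in nhds X. aff_pt (affine_expr G x) = G (aff_pt x) \<and>
      affine_expr G x = X + (1 / g x) *\<^sub>R K (x - X)"
  proof eventually_elim
    case (elim x)
    have a: "affine_expr G x = (1 / g x) *\<^sub>R fst2 (A *v homog x)"
      using elim by (intro affine_expr_proj_pt[where G = G and x = x, OF Gx, folded g_def])
    have h: "homog x = homog X + (homog (x - X) - homog 0)"
      by (simp add: vec_eq_iff forall_3)
    have "chart_part X (A *v homog x) = chart_part X (A *v homog X) + K (x - X)"
      by (subst h) (simp add: matrix_vector_right_distrib chart_part_add K_def)
    also have "chart_part X (A *v homog X) = 0"
      by (simp add: X chart_part_scaleR chart_part_homog)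
    finally have "fst2 (A *v homog x) = g x *\<^sub>R X + K (x - X)"
      by (simp add: chart_part_def g_def algebra_simps)
    then show ?case
      using a elim proj_pt_affine[of "A *v homog x"] by (simp add: Gx g_def scaleR_add_right)
  qed
  then show "\<forall>\<^sub>F x in nhds X. aff_pt (affine_expr G x) = G (aff_pt x)"
    by (rule eventually_mono) blast
  \<comment> \<open>In the product rule the derivative of \<open>1 / g\<close> is multiplied by
    \<open>K 0\<close>, so it drops out at \<open>X\<close>.\<close>
  have K0: "K 0 = 0" using K by (rule linear_0)
  have KD: "((\<lambda>x. K (x - X)) has_derivative K) (at X)"
    using linear_conv_bounded_linear[THEN iffD1, OF K]
    by (auto intro!: derivative_eq_intros bounded_linear.has_derivative[where f = K])
  have gD: "((\<lambda>x. 1 / g x) has_derivative (\<lambda>h. - ((A$3$1 * h$1 + A$3$2 * h$2) / lam\<^sup>2))) (at X)"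
    using gX lam by (auto intro!: derivative_eq_intros gd simp: power2_eq_square field_simps)
  have "((\<lambda>x. X + (1 / g x) *\<^sub>R K (x - X)) has_derivative (\<lambda>h. (1 / lam) *\<^sub>R K h)) (at X)"
    using has_derivative_add[OF has_derivative_const[of X] has_derivative_scaleR[OF gD KD]]
    by (simp add: K0 gX)
  then have "(affine_expr G has_derivative (\<lambda>h. (1 / lam) *\<^sub>R K h)) (at X)"
  proof (rule has_derivative_transform_eventually)
    show "\<forall>\<^sub>F x in at X. X + (1 / g x) *\<^sub>R K (x - X) = affine_expr G x"
      using ev by (auto simp: eventually_nhds_conv_at elim: eventually_mono)
    show "X + (1 / g X) *\<^sub>R K (X - X) = affine_expr G X"
      using ev by (auto simp: eventually_nhds_conv_at)
  qed simp
  then show "(affine_expr G has_derivative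
      (\<lambda>h. (1 / lam) *\<^sub>R chart_part X (A *v (homog h - homog 0)))) (at X)"
    by (simp add: K_def)
qed

lemma projectivity_iterate:
  assumes "represents_projectivity A G" "v \<noteq> 0"
  shows "(G ^^ q) (proj_pt v) = proj_pt (((*v) A ^^ q) v)"
proof -
  have "(G ^^ q) (proj_pt v) = proj_pt (((*v) A ^^ q) v) \<and> ((*v) A ^^ q) v \<noteq> 0"
    using assms by (induction q) (auto simp: represents_projectivity_def invertible_mult_nonzero)
  then show ?thesis ..
qed


section \<open>Matrices conjugate to a rotation\<close>

text \<open>An eigenvector exists exactly when the characteristic matrix is singular. Trace and
  determinant, both conjugation invariant, then suffice to find the spectrum.\<close>

lemma spectrum_2x2:
  "spectrum (R :: real^2^2) = {z. z\<^sup>2 - complex_of_real (trace R) * z + complex_of_real (det R) = 0}"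
proof -
  have "(\<exists>v. eigenvector (complex_matrix R) z v) \<longleftrightarrow> det (complex_matrix R - mat z) = 0" for z
  proof -
    have "complex_matrix R *v v = z *s v \<longleftrightarrow> (complex_matrix R - mat z) *v v = 0" for v
      by (simp add: vec_eq_iff forall_2 matrix_vector_mult_def sum_2 mat_def algebra_simps)
    then show ?thesis
      using invertible_det_nz[of "complex_matrix R - mat z"]
      by (auto simp: eigenvector_def invertible_left_inverse matrix_left_invertible_ker)
  qed
  moreover have "det (complex_matrix R - mat z) = z\<^sup>2 - complex_of_real (trace R) * z + complex_of_real (det R)" for z
    by (simp add: det_2 complex_matrix_def map_matrix_def mat_def trace_def sum_2 power2_eq_square algebra_simps)
  ultimately show ?thesis
    by (simp add: spectrum_def)
qed

section \<open>Perturbation of planar determinants\<close>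

lemma abs_det2_le: "\<bar>det2 u v\<bar> \<le> 2 * (norm u * norm v)"
proof -
  have "\<bar>det2 u v\<bar> \<le> \<bar>u$1\<bar> * \<bar>v$2\<bar> + \<bar>u$2\<bar> * \<bar>v$1\<bar>"
    unfolding det2_eq abs_mult[symmetric] by (rule abs_triangle_ineq4)
  also have "\<dots> \<le> norm u * norm v + norm u * norm v"
    by (intro add_mono mult_mono component_le_norm_cart) auto
  finally show ?thesis by simp
qed

text \<open>Bilinearity splits the difference into three terms, each with a factor tending to 0. The
  references \<open>a'\<close> and \<open>b'\<close> are only assumed bounded, as they will be
  rotating orbits without a limit.\<close>

lemma det2_tendsto_diff:
  fixes a b a' b' :: "nat \<Rightarrow> real^2"
  assumes a: "(\<lambda>q. a q - a' q) \<longlonglongrightarrow> 0" and b: "(\<lambda>q. b q - b' q) \<longlonglongrightarrow> 0"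
    and a': "\<And>q. norm (a' q) \<le> Ka" and b': "\<And>q. norm (b' q) \<le> Kb"
  shows "(\<lambda>q. det2 (a q) (b q) - det2 (a' q) (b' q)) \<longlonglongrightarrow> 0"
proof (rule Lim_null_comparison)
  let ?u = "\<lambda>q. norm (a q - a' q)" and ?v = "\<lambda>q. norm (b q - b' q)"
  show "\<forall>\<^sub>F q in sequentially. norm (det2 (a q) (b q) - det2 (a' q) (b' q))
      \<le> 2 * (?u q * ?v q) + 2 * (?u q * Kb) + 2 * (Ka * ?v q)"
  proof (rule always_eventually, rule allI)
    fix q
    have "det2 (a q) (b q) - det2 (a' q) (b' q) =
        det2 (a q - a' q) (b q - b' q) + det2 (a q - a' q) (b' q) + det2 (a' q) (b q - b' q)"
      by (simp add: det2_eq algebra_simps)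
    moreover have "\<bar>det2 (a q - a' q) (b' q)\<bar> \<le> 2 * (?u q * Kb)"
      using b'[of q] by (intro order_trans[OF abs_det2_le]) (simp add: mult_left_mono)
    moreover have "\<bar>det2 (a' q) (b q - b' q)\<bar> \<le> 2 * (Ka * ?v q)"
      using a'[of q] by (intro order_trans[OF abs_det2_le]) (simp add: mult_right_mono)
    ultimately show "norm (det2 (a q) (b q) - det2 (a' q) (b' q))
      \<le> 2 * (?u q * ?v q) + 2 * (?u q * Kb) + 2 * (Ka * ?v q)"
      using abs_det2_le[of "a q - a' q" "b q - b' q"] by simp
  qed
  have u: "?u \<longlonglongrightarrow> 0" and v: "?v \<longlonglongrightarrow> 0"
    using a b by (simp_all add: tendsto_norm_zero)
  show "(\<lambda>q. 2 * (?u q * ?v q) + 2 * (?u q * Kb) + 2 * (Ka * ?v q)) \<longlonglongrightarrow> 0"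
    using tendsto_add[OF tendsto_add[OF tendsto_mult_right_zero[OF tendsto_mult[OF u v, simplified], of 2]
          tendsto_mult_right_zero[OF tendsto_mult_left_zero[OF u, of Kb], of 2]]
        tendsto_mult_right_zero[OF tendsto_mult_right_zero[OF v, of Ka], of 2]]
    by simp
qed

locale conjugate_rotation =
  fixes R S T :: "real^2^2"
  assumes invS: "invertible S" and RS: "R ** S = S ** T" and rotT: "rotation_matrix T"
begin

abbreviation iter :: "nat \<Rightarrow> real^2 \<Rightarrow> real^2" where
  "iter q \<equiv> (*v) R ^^ q"

lemma S_inverse [simp]: "matrix_inv S ** S = mat 1" "S ** matrix_inv S = mat 1"
  using someI_ex[OF invS[unfolded invertible_def]] unfolding matrix_inv_def by auto

lemma S_inverse_mult [simp]: "matrix_inv S *v (S *v x) = x" "S *v (matrix_inv S *v x) = x"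
  by (simp_all add: matrix_vector_mul_assoc)

lemma conj_eq: "matrix_inv S ** R ** S = T"
  by (metis RS S_inverse(1) matrix_mul_assoc matrix_mul_lid)

lemma R_eq: "R = S ** T ** matrix_inv S"
  by (metis RS S_inverse(2) matrix_mul_assoc matrix_mul_rid)

lemma det_R: "det R = 1"
proof -
  have "det R * det S = det S * det T"
    using RS by (metis det_mul)
  moreover have "det S \<noteq> 0" using invS invertible_det_nz by blast
  ultimately show ?thesis using rotT by (simp add: rotation_matrix_def)
qed

lemma trace_R: "trace R = trace T"
  by (metis conj_eq R_eq S_inverse(1) matrix_mul_assoc matrix_mul_lid matrix_mul_rid trace_mul_sym)

lemma norm_T: "norm (T *v c) = norm c"
  using rotT orthogonal_transformation_matrix[of "(*v) T"]
  by (simp add: rotation_matrix_def orthogonal_transformation)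

text \<open>The squared Euclidean norm in the coordinates given by \<open>S\<close>, where
  \<open>R\<close> acts as the orthogonal matrix \<open>T\<close>; it serves as the quadratic form
  of the theorem.\<close>

definition form :: "real^2 \<Rightarrow> real" where
  "form x = (norm (matrix_inv S *v x))\<^sup>2"

lemma form_S: "form (S *v x) = (norm x)\<^sup>2"
  by (simp add: form_def)

lemma form_R: "form (R *v x) = form x"
proof -
  have "R *v x = S *v (T *v (matrix_inv S *v x))"
    by (simp add: R_eq matrix_vector_mul_assoc matrix_mul_assoc)
  then show ?thesis by (simp add: form_def norm_T)
qed

lemma form_scaleR: "form (c *\<^sub>R x) = c\<^sup>2 * form x"
  by (simp add: form_def matrix_vector_mult_scaleR power_mult_distrib)

lemma pos_def_form: "pos_def_quadratic_form form"
proof -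
  define b where "b x y = (matrix_inv S *v x) \<bullet> (matrix_inv S *v y)" for x y
  have "bilinear b"
    unfolding bilinear_def b_def
    by (auto intro!: linearI simp: matrix_vector_right_distrib matrix_vector_mult_scaleR inner_add)
  then have "quadratic_form form"
    unfolding quadratic_form_def by (intro exI[of _ b])
      (simp add: b_def form_def inner_commute power2_norm_eq_inner)
  moreover have "form x > 0" if "x \<noteq> 0" for x
    using that S_inverse_mult(2)[of x] by (cases "matrix_inv S *v x = 0") (simp_all add: form_def)
  ultimately show ?thesis by (simp add: pos_def_quadratic_form_def)
qed

lemma rotation_for_form: "rotation_for form R"
  unfolding rotation_for_def using invS rotT by (intro exI[of _ S]) (simp add: form_S conj_eq)

lemma linear_iter: "linear (iter q)"
proof (induction q)
  case 0
  then show ?case by (simp add: linear_id[unfolded id_def] id_def)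
next
  case (Suc q)
  then show ?case using linear_compose[OF _ matrix_vector_mul_linear] by (simp only: funpow.simps)
qed

lemma form_iter: "form (iter q x) = form x"
  by (induction q) (simp_all add: form_R)

text \<open>Since \<open>det R = 1\<close>, the limiting shape may keep turning while its area stays
  constant.\<close>

lemma det2_iter: "det2 (iter q u) (iter q v) = det2 u v"
proof (induction q)
  case (Suc q)
  have "det2 (R *v x) (R *v y) = det R * det2 x y" for x y
    by (simp add: det2_eq det_2 matrix_vector_mult_def sum_2 algebra_simps)
  with Suc show ?case by (simp add: det_R)
qed simp

lemma form_bound: obtains K where "K > 0" "\<And>x. norm x \<le> K * sqrt (form x)"
proof -
  obtain K where K: "K > 0" "\<And>c. norm (S *v c) \<le> norm c * K"
    using bounded_linear.pos_bounded[OF matrix_vector_mul_bounded_linear[of S]] by blast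
  have "norm x \<le> K * sqrt (form x)" for x
    using K(2)[of "matrix_inv S *v x"] by (simp add: form_def mult.commute)
  with K(1) that show ?thesis by blast
qed

lemma iter_bounded: obtains K where "\<And>q. norm (iter q x) \<le> K"
  using form_bound form_iter by metis

lemma continuous_form: "continuous_on UNIV form"
  unfolding form_def by (intro continuous_intros linear_continuous_on matrix_vector_mul_bounded_linear)

text \<open>The form is constant along an orbit and continuous, so an orbit tending to 0 starts at a
  point of form value 0.\<close>

lemma iter_tendsto_0_imp_0:
  assumes "(\<lambda>q. iter q d) \<longlonglongrightarrow> 0"
  shows "d = 0"
proof -
  have "(\<lambda>q. form (iter q d)) \<longlonglongrightarrow> form 0"
    using continuous_on_tendsto_compose[OF continuous_form assms] by simp
  then have "form d = 0"
    by (simp add: form_iter LIMSEQ_const_iff) (simp add: form_def)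
  then show "d = 0"
    using pos_def_form by (metis less_irrefl pos_def_quadratic_form_def)
qed

text \<open>The square root of the form is an \<open>R\<close>-invariant norm, so the reverse
  triangle inequality gives the first limit. For the second, \<open>iter q x\<close> lies on the
  level set and bounds the distance.\<close>

lemma form_tendsto:
  assumes y: "(\<lambda>q. y q - iter q x) \<longlonglongrightarrow> 0"
  shows "(\<lambda>q. form (y q)) \<longlonglongrightarrow> form x"
    and "(\<lambda>q. infdist (y q) {v. form v = form x}) \<longlonglongrightarrow> 0"
proof -
  define s where "s v = sqrt (form v)" for v
  have s: "s v = norm (matrix_inv S *v v)" for v
    by (simp add: s_def form_def)
  have "(\<lambda>q. matrix_inv S *v (y q - iter q x)) \<longlonglongrightarrow> matrix_inv S *v 0"
    by (intro bounded_linear.tendsto[OF matrix_vector_mul_bounded_linear] y)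
  then have lim: "(\<lambda>q. norm (matrix_inv S *v (y q - iter q x))) \<longlonglongrightarrow> 0"
    by (simp add: tendsto_norm_zero)
  have "(\<lambda>q. s (y q) - s x) \<longlonglongrightarrow> 0"
  proof (rule Lim_null_comparison[OF _ lim])
    have "\<bar>s (y q) - s x\<bar> \<le> norm (matrix_inv S *v (y q - iter q x))" for q
    proof -
      have "s x = s (iter q x)" by (simp add: s_def form_iter)
      then show ?thesis
        unfolding s matrix_vector_mult_diff_distrib by (metis norm_triangle_ineq3)
    qed
    then show "\<forall>\<^sub>F q in sequentially. norm (s (y q) - s x) \<le> norm (matrix_inv S *v (y q - iter q x))"
      by simp
  qed
  then have "(\<lambda>q. s (y q)) \<longlonglongrightarrow> s x"
    by (simp add: LIM_zero_iff)
  then have "(\<lambda>q. (s (y q))\<^sup>2) \<longlonglongrightarrow> (s x)\<^sup>2"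
    by (rule tendsto_power)
  then show "(\<lambda>q. form (y q)) \<longlonglongrightarrow> form x"
    by (simp add: s form_def)
  show "(\<lambda>q. infdist (y q) {v. form v = form x}) \<longlonglongrightarrow> 0"
  proof (rule Lim_null_comparison[OF _ tendsto_norm_zero[OF y]])
    have "infdist (y q) {v. form v = form x} \<le> norm (y q - iter q x)" for q
      using infdist_le[of "iter q x" "{v. form v = form x}" "y q"]
      by (simp add: form_iter dist_norm)
    then show "\<forall>\<^sub>F q in sequentially. norm (infdist (y q) {v. form v = form x}) \<le> norm (y q - iter q x)"
      by (simp add: infdist_nonneg)
  qed
qed

section \<open>Limit under area normalization\<close>

lemma iter_centroid: "iter q (centroid n \<xi>) = centroid n (\<lambda>i. iter q (\<xi> i))"
  using linear_iter by (simp add: centroid_def linear_scale linear_sum)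

text \<open>The vertices \<open>Y q i\<close> collapse to \<open>X\<close>; dividing by \<open>\<tau> ^ q\<close> undoes the collapse, and the
  area normalization is insensitive to this rescaling.\<close>

lemma area_normalized_limit:
  assumes \<tau>: "0 < \<tau>" "\<tau> < 1" and n: "n \<ge> 1"
    and per: "\<And>q i. Y q (i + int n) = Y q i"
    and ex: "\<And>i. (\<lambda>q. norm (Y q i - (X + \<tau> ^ q *\<^sub>R iter q (\<xi> i)))) \<in> O(\<lambda>q. \<tau> ^ (2 * q))"
    and w: "\<And>i. w i = \<xi> i - centroid n \<xi>"
    and B: "area n w > 0" and A: "A > 0"
  shows "(\<lambda>q. sqrt (A / area n (Y q)) *\<^sub>R (Y q i - centroid n (Y q)) -
      sqrt (A / area n w) *\<^sub>R iter q (w i)) \<longlonglongrightarrow> 0"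
proof -
  define U where "U q i = (1 / \<tau> ^ q) *\<^sub>R (Y q i - X)" for q i
  define Z where "Z q i = U q i - centroid n (U q)" for q i
  have Ui: "(\<lambda>q. U q i - iter q (\<xi> i)) \<longlonglongrightarrow> 0" for i
  proof -
    obtain C where C: "\<forall>\<^sub>F q in sequentially. norm (norm (Y q i - (X + \<tau> ^ q *\<^sub>R iter q (\<xi> i)))) \<le> C * norm (\<tau> ^ (2 * q))"
      using ex[of i] by (elim landau_o.bigE) blast
    have "\<forall>\<^sub>F q in sequentially. norm (U q i - iter q (\<xi> i)) \<le> C * \<tau> ^ q"
      using C
    proof eventually_elim
      case (elim q)
      have "U q i - iter q (\<xi> i) = (1 / \<tau> ^ q) *\<^sub>R (Y q i - (X + \<tau> ^ q *\<^sub>R iter q (\<xi> i)))"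
        using \<tau> by (simp add: U_def algebra_simps)
      then have "norm (U q i - iter q (\<xi> i)) = norm (Y q i - (X + \<tau> ^ q *\<^sub>R iter q (\<xi> i))) / \<tau> ^ q"
        using \<tau> by simp
      also have "\<dots> \<le> C * \<tau> ^ (2 * q) / \<tau> ^ q"
        using elim \<tau> by (intro divide_right_mono) auto
      also have "\<dots> = C * \<tau> ^ q"
        using \<tau> by (simp add: mult_2 power_add)
      finally show ?case .
    qed
    moreover have "(\<lambda>q. C * \<tau> ^ q) \<longlonglongrightarrow> 0"
      using \<tau> by (intro tendsto_mult_right_zero LIMSEQ_power_zero) auto
    ultimately show ?thesis by (rule Lim_null_comparison)
  qed
  have cU: "(\<lambda>q. centroid n (U q) - iter q (centroid n \<xi>)) \<longlonglongrightarrow> 0"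
  proof -
    have "(\<lambda>q. (1 / real n) *\<^sub>R (\<Sum>i=1..int n. U q i - iter q (\<xi> i))) \<longlonglongrightarrow> (1 / real n) *\<^sub>R (\<Sum>i=1..int n. 0)"
      by (intro tendsto_intros Ui)
    then show ?thesis
      by (simp add: iter_centroid) (simp add: centroid_def sum_subtractf scaleR_diff_right)
  qed
  have Zi: "(\<lambda>q. Z q i - iter q (w i)) \<longlonglongrightarrow> 0" for i
    using tendsto_diff[OF Ui[of i] cU] by (simp add: Z_def w linear_diff[OF linear_iter] algebra_simps)
  have "(\<lambda>q. det2 (Z q i) (Z q (i + 1)) - det2 (iter q (w i)) (iter q (w (i + 1)))) \<longlonglongrightarrow> 0" for i
  proof -
    obtain K K' where "\<And>q. norm (iter q (w i)) \<le> K" "\<And>q. norm (iter q (w (i + 1))) \<le> K'"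
      using iter_bounded by metis
    then show ?thesis by (rule det2_tendsto_diff[OF Zi Zi])
  qed
  then have dZ: "(\<lambda>q. det2 (Z q i) (Z q (i + 1))) \<longlonglongrightarrow> det2 (w i) (w (i + 1))" for i
    by (simp add: det2_iter LIM_zero_iff)
  have aZ: "(\<lambda>q. area n (Z q)) \<longlonglongrightarrow> area n w"
    unfolding area_def by (intro tendsto_intros dZ)
  have perZ: "Z q (i + int n) = Z q i" for q i by (simp add: Z_def U_def per)
  \<comment> \<open>\<open>Y q\<close> is a similar copy of \<open>Z q\<close> with ratio
    \<open>\<tau> ^ q\<close>; this ratio cancels between the vertex vectors and the root of the
    area.\<close>
  have Y: "Y q = (\<lambda>i. (X + \<tau> ^ q *\<^sub>R centroid n (U q)) + \<tau> ^ q *\<^sub>R Z q i)" for q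
    using \<tau> by (simp add: Z_def U_def fun_eq_iff algebra_simps)
  have aY: "area n (Y q) = (\<tau> ^ q)\<^sup>2 * area n (Z q)" for q
    by (subst Y, rule area_similarity) (rule perZ)
  have cZ: "centroid n (Z q) = 0" for q
    using centroid_similarity[OF n, of "- centroid n (U q)" 1 "U q"] by (simp add: Z_def[abs_def])
  have YZ: "Y q i - centroid n (Y q) = \<tau> ^ q *\<^sub>R Z q i" for q
    by (subst (1 2) Y) (simp add: centroid_similarity[OF n] cZ)
  have norm_eq: "sqrt (A / area n (Y q)) *\<^sub>R (Y q i - centroid n (Y q)) = sqrt (A / area n (Z q)) *\<^sub>R Z q i" for q
    using \<tau> by (simp add: YZ aY real_sqrt_divide real_sqrt_mult)
  \<comment> \<open>The error is split into a convergent factor times a vanishing vertex error, and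
    a vanishing factor error times the bounded orbit.\<close>
  obtain K where K: "\<And>q. norm (iter q (w i)) \<le> K"
    using iter_bounded by metis
  have sq: "(\<lambda>q. sqrt (A / area n (Z q))) \<longlonglongrightarrow> sqrt (A / area n w)"
    using B by (intro tendsto_intros aZ) auto
  then have 1: "(\<lambda>q. sqrt (A / area n (Z q)) *\<^sub>R (Z q i - iter q (w i))) \<longlonglongrightarrow> 0"
    using tendsto_scaleR[OF sq Zi] by simp
  have 2: "(\<lambda>q. (sqrt (A / area n (Z q)) - sqrt (A / area n w)) *\<^sub>R iter q (w i)) \<longlonglongrightarrow> 0"
  proof (rule Lim_null_comparison)
    show "\<forall>\<^sub>F q in sequentially. norm ((sqrt (A / area n (Z q)) - sqrt (A / area n w)) *\<^sub>R iter q (w i))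
        \<le> \<bar>sqrt (A / area n (Z q)) - sqrt (A / area n w)\<bar> * K"
      using K by (simp add: mult_left_mono)
    show "(\<lambda>q. \<bar>sqrt (A / area n (Z q)) - sqrt (A / area n w)\<bar> * K) \<longlonglongrightarrow> 0"
      using sq by (intro tendsto_mult_left_zero tendsto_rabs_zero) (simp add: LIM_zero_iff)
  qed
  show ?thesis
    using tendsto_add[OF 1 2] unfolding norm_eq by (simp add: algebra_simps)
qed

section \<open>First-order expansions of orbits\<close>

lemma iter_S: "iter q (S *v c) = S *v ((*v) T ^^ q) c"
proof (induction q)
  case (Suc q)
  have "R *v (S *v x) = S *v (T *v x)" for x
    by (simp add: matrix_vector_mul_assoc RS)
  with Suc show ?case by simp
qed simp

lemma norm_T_iter: "norm (((*v) T ^^ q) c) = norm c"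
  by (induction q) (simp_all add: norm_T)

text \<open>Two expansions differ by \<tau>^q R^q(x - y), which is O(\<tau>^(2q)). Dividing by
  \<tau>^q makes the orbit of \<open>x - y\<close> tend to 0, so \<open>x = y\<close>.\<close>

lemma first_order_expansion_unique:
  assumes \<tau>: "0 < \<tau>" "\<tau> < 1"
    and x: "first_order_expansion G X \<tau> R p x" and y: "first_order_expansion G X \<tau> R p y"
  shows "x = y"
proof -
  let ?E = "\<lambda>x q. affine_expr (G ^^ q) p - (X + \<tau> ^ q *\<^sub>R iter q x)"
  have "(\<lambda>q. norm (?E x q) + norm (?E y q)) \<in> O(\<lambda>q. \<tau> ^ (2 * q))"
    using x y unfolding first_order_expansion_def by (rule sum_in_bigo)
  then obtain C where C: "\<forall>\<^sub>F q in sequentially. norm (norm (?E x q) + norm (?E y q)) \<le> C * norm (\<tau> ^ (2 * q))"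
    by (elim landau_o.bigE) blast
  have "\<forall>\<^sub>F q in sequentially. norm (iter q (x - y)) \<le> C * \<tau> ^ q"
    using C
  proof eventually_elim
    case (elim q)
    have "\<tau> ^ q *\<^sub>R iter q (x - y) = ?E y q - ?E x q"
      by (simp add: linear_diff[OF linear_iter] algebra_simps)
    then have "norm (\<tau> ^ q *\<^sub>R iter q (x - y)) \<le> norm (?E x q) + norm (?E y q)"
      using norm_triangle_ineq4[of "?E y q" "?E x q"] by (simp add: add.commute)
    with elim have "\<tau> ^ q * norm (iter q (x - y)) \<le> C * \<tau> ^ (2 * q)"
      using \<tau> by simp
    also have "\<dots> = \<tau> ^ q * (C * \<tau> ^ q)"
      by (simp add: mult_2 power_add)
    finally have "\<tau> ^ q * norm (iter q (x - y)) \<le> \<tau> ^ q * (C * \<tau> ^ q)" .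
    then show ?case using \<tau> by simp
  qed
  moreover have "(\<lambda>q. C * \<tau> ^ q) \<longlonglongrightarrow> 0"
    using \<tau> by (intro tendsto_mult_right_zero LIMSEQ_power_zero) auto
  ultimately have "(\<lambda>q. iter q (x - y)) \<longlonglongrightarrow> 0"
    by (rule Lim_null_comparison)
  then show ?thesis using iter_tendsto_0_imp_0 by fastforce
qed

text \<open>In the frame the iterates of \<open>A\<close> act on \<open>homog x\<close> by scaling the component along
  \<open>homog X\<close> by \<open>lam ^ q\<close> and rotating the remaining component with ratio \<open>\<tau> ^ q\<close> relative to it;
  dehomogenizing turns this into a geometric series whose first-order term is \<open>(x - X) / \<gamma>\<close>.\<close>

lemma first_order_expansion_frame:
  assumes G: "represents_projectivity A G"
    and X: "A *v homog X = lam *\<^sub>R homog X" "lam \<noteq> 0"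
    and L: "linear L" "\<And>c. A *v L c = (lam * \<tau>) *\<^sub>R L (T *v c)" "\<And>c. S *v c = chart_part X (L c)"
    and x: "homog x = \<gamma> *\<^sub>R homog X + L c" and \<gamma>: "\<gamma> \<noteq> 0"
    and \<tau>: "0 < \<tau>" "\<tau> < 1"
  shows "first_order_expansion G X \<tau> R x ((1 / \<gamma>) *\<^sub>R (x - X))"
proof -
  define e where "e q = (L (((*v) T ^^ q) c))$3" for q
  obtain E where E: "E > 0" "\<And>c. norm (L c) \<le> norm c * E"
    using bounded_linear.pos_bounded[OF linear_conv_bounded_linear[THEN iffD1, OF L(1)]] by blast
  have e: "\<bar>e q\<bar> \<le> norm c * E" for q
    using order_trans[OF component_le_norm_cart E(2)] by (metis e_def norm_T_iter)
  \<comment> \<open>\<open>chart_part X\<close> kills the component along \<open>homog X\<close>, so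
    \<open>c\<close> holds the frame coordinates of \<open>x - X\<close>.\<close>
  have Sc: "S *v c = x - X"
  proof -
    have "x - X = chart_part X (\<gamma> *\<^sub>R homog X + L c)"
      by (simp add: x[symmetric] chart_part_homog)
    then show ?thesis by (simp add: chart_part_add chart_part_scaleR chart_part_homog L(3))
  qed
  have y: "((*v) A ^^ q) (homog x) = lam ^ q *\<^sub>R (\<gamma> *\<^sub>R homog X + \<tau> ^ q *\<^sub>R L (((*v) T ^^ q) c))" for q
    by (induction q) (simp_all add: x matrix_vector_mult_scaleR matrix_vector_right_distrib X(1) L(2)
        algebra_simps)
  have y3: "(((*v) A ^^ q) (homog x))$3 = lam ^ q * (\<gamma> + \<tau> ^ q * e q)" for q
    by (simp add: y e_def)
  have cy: "chart_part X (((*v) A ^^ q) (homog x)) = (lam ^ q * \<tau> ^ q) *\<^sub>R iter q (x - X)" for q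
    unfolding Sc[symmetric] iter_S y chart_part_scaleR chart_part_add L(3)[symmetric]
    by (simp add: chart_part_homog)
  have expr: "affine_expr (G ^^ q) x = X + (\<tau> ^ q / (\<gamma> + \<tau> ^ q * e q)) *\<^sub>R iter q (x - X)"
    if nz: "\<gamma> + \<tau> ^ q * e q \<noteq> 0" for q
  proof -
    let ?y = "((*v) A ^^ q) (homog x)"
    have nz': "?y$3 \<noteq> 0" using nz X(2) by (simp add: y3)
    have "affine_expr (G ^^ q) x = (1 / ?y$3) *\<^sub>R fst2 ?y"
      by (rule affine_expr_proj_pt) (simp_all add: nz' aff_pt_homog projectivity_iterate[OF G])
    also have "fst2 ?y = ?y$3 *\<^sub>R X + (lam ^ q * \<tau> ^ q) *\<^sub>R iter q (x - X)"
      using cy[of q] by (simp add: chart_part_def algebra_simps)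
    finally show ?thesis
      using nz' X(2) by (simp add: scaleR_add_right y3)
  qed
  obtain K where K: "\<And>q. norm (iter q (x - X)) \<le> K"
    using iter_bounded by metis
  have K0: "K \<ge> 0" using K norm_ge_zero order_trans by blast
  \<comment> \<open>Eventually the denominator stays at distance less than half of
    \<open>\<bar>\<gamma>\<bar>\<close> from \<open>\<gamma>\<close>, so it is nonzero and its
    reciprocal is uniformly bounded.\<close>
  have "(\<lambda>q. \<tau> ^ q * (norm c * E)) \<longlonglongrightarrow> 0"
    using \<tau> by (intro tendsto_mult_left_zero LIMSEQ_power_zero) auto
  then have "\<forall>\<^sub>F q in sequentially. \<tau> ^ q * (norm c * E) < \<bar>\<gamma>\<bar> / 2"
    using \<gamma> by (intro order_tendstoD) auto
  then have "\<forall>\<^sub>F q in sequentially. norm (affine_expr (G ^^ q) x - (X + \<tau> ^ q *\<^sub>R iter q ((1 / \<gamma>) *\<^sub>R (x - X))))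
      \<le> (norm c * E) * K / (\<gamma>\<^sup>2 / 2) * norm (\<tau> ^ (2 * q))"
  proof eventually_elim
    case (elim q)
    define d where "d = \<gamma> + \<tau> ^ q * e q"
    have "\<bar>\<tau> ^ q * e q\<bar> \<le> \<tau> ^ q * (norm c * E)"
      using e[of q] \<tau> by (simp add: abs_mult)
    moreover have "\<bar>\<gamma>\<bar> \<le> \<bar>d\<bar> + \<bar>\<tau> ^ q * e q\<bar>"
      unfolding d_def by arith
    ultimately have d: "\<bar>d\<bar> \<ge> \<bar>\<gamma>\<bar> / 2"
      using elim by linarith
    with \<gamma> have d0: "d \<noteq> 0" by auto
    \<comment> \<open>This difference supplies the second factor \<open>\<tau> ^ q\<close> of the
      error.\<close>
    have \<gamma>d: "\<gamma> - d = - (\<tau> ^ q * e q)" by (simp add: d_def)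
    have "\<tau> ^ q / d - \<tau> ^ q / \<gamma> = \<tau> ^ q * (\<gamma> - d) / (\<gamma> * d)"
      using d0 \<gamma> by (simp add: field_simps)
    then have "\<tau> ^ q / d - \<tau> ^ q / \<gamma> = - (\<tau> ^ (2 * q) * e q / (\<gamma> * d))"
      unfolding \<gamma>d by (simp add: mult_2 power_add)
    moreover have "affine_expr (G ^^ q) x - (X + \<tau> ^ q *\<^sub>R iter q ((1 / \<gamma>) *\<^sub>R (x - X)))
        = (\<tau> ^ q / d - \<tau> ^ q / \<gamma>) *\<^sub>R iter q (x - X)"
      using expr[of q] d0 by (simp add: d_def linear_scale[OF linear_iter] scaleR_diff_left)
    ultimately have "norm (affine_expr (G ^^ q) x - (X + \<tau> ^ q *\<^sub>R iter q ((1 / \<gamma>) *\<^sub>R (x - X))))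
        = \<tau> ^ (2 * q) * \<bar>e q\<bar> / (\<bar>\<gamma>\<bar> * \<bar>d\<bar>) * norm (iter q (x - X))"
      using \<tau> by (simp add: abs_mult)
    also have "\<dots> \<le> \<tau> ^ (2 * q) * (norm c * E) / (\<bar>\<gamma>\<bar> * (\<bar>\<gamma>\<bar> / 2)) * K"
      using \<tau> \<gamma> e[of q] d K[of q] E(1) K0
      by (intro mult_mono frac_le mult_left_mono) (auto simp: zero_less_mult_iff)
    finally show ?case
      using \<tau> by (simp add: power2_eq_square algebra_simps)
  qed
  then have "(\<lambda>q. norm (affine_expr (G ^^ q) x - (X + \<tau> ^ q *\<^sub>R iter q ((1 / \<gamma>) *\<^sub>R (x - X)))))
      \<in> O(\<lambda>q. \<tau> ^ (2 * q))"
    by (intro bigoI[of _ "norm c * E * K / (\<gamma>\<^sup>2 / 2)"]) simp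
  then show ?thesis by (simp add: first_order_expansion_def)
qed

end

text \<open>The chart direction \<open>S *v c\<close> lifts to \<open>L c\<close> up to a multiple
  of \<open>homog X\<close>. That multiple stays on the eigenline and is killed by
  \<open>chart_part\<close>, so the derivative at \<open>X\<close> acts in the frame as
  \<open>\<tau>\<close> times \<open>T\<close>.\<close>

lemma derivative_frame:
  assumes "linear L" "A *v homog X = lam *\<^sub>R homog X" "lam \<noteq> 0"
    and "A *v L c = (lam * \<tau>) *\<^sub>R L (T *v c)" "\<And>c. S *v c = chart_part X (L c)"
  shows "(1 / lam) *\<^sub>R chart_part X (A *v (homog (S *v c) - homog 0)) = \<tau> *\<^sub>R (S *v (T *v c))"
proof -
  have "homog (S *v c) - homog 0 = L c + (- (L c)$3) *\<^sub>R homog X"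
    using assms(5)[of c] by (simp add: vec_eq_iff forall_3 chart_part_def)
  then have "chart_part X (A *v (homog (S *v c) - homog 0)) = (lam * \<tau>) *\<^sub>R (S *v (T *v c))"
    by (simp only: matrix_vector_right_distrib matrix_vector_mult_scaleR chart_part_add
        chart_part_scaleR chart_part_homog assms(2,4,5)) simp
  then show ?thesis using assms(3) by simp
qed

theorem proposition6p2:
  fixes n m :: nat and s :: int
    and P :: "int \<Rightarrow> real^2" and Q :: "nat \<Rightarrow> int \<Rightarrow> real^2"
    and G :: "rp2 \<Rightarrow> rp2" and Gt :: "real^3^3"
    and lam1 \<rho> \<theta> \<tau> \<phi> :: real and v1 :: "real^3" and X1 :: "real^2"
    and f :: "real^2 \<Rightarrow> real^2" and M R :: "real^2^2"
    and \<xi> w :: "nat \<Rightarrow> int \<Rightarrow> real^2" and B :: "nat \<Rightarrow> real"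
    and Pn :: "nat \<Rightarrow> int \<Rightarrow> real^2" and Pt :: "nat \<Rightarrow> nat \<Rightarrow> int \<Rightarrow> real^2"
    and C0 :: "real^2" and A0 :: real
  assumes polygon: "polygon n P"
    and m: "m \<ge> 1"
    and G: "represents_projectivity Gt G"
    and periodic: "aff_pt \<circ> (pentagram ^^ m) P = relabel s (G \<circ> (aff_pt \<circ> P))"
    and iterates: "\<forall>k. pentagram_defined ((pentagram ^^ k) P) \<and> area n ((pentagram ^^ k) P) \<noteq> 0"
    and spectrum: "spectrum Gt =
      {complex_of_real lam1, complex_of_real \<rho> * cis \<theta>, complex_of_real \<rho> * cis (- \<theta>)}"
    and simple: "simple_eigenvalue Gt (complex_of_real lam1)"
    and \<rho>: "\<rho> > 0" and \<theta>: "0 < \<theta>" "\<theta> < pi" and dominant: "\<bar>lam1\<bar> > \<rho>"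
    and v1: "eigenvector Gt lam1 v1"
    and X1: "proj_pt v1 = aff_pt X1"
    and f: "f = affine_expr G"
    and \<tau>: "\<tau> = \<rho> / \<bar>lam1\<bar>"
    and \<phi>: "(complex_of_real \<rho> * cis \<theta>) / complex_of_real lam1 = complex_of_real \<tau> * cis \<phi>"
    and Q: "\<forall>r. Q r = (pentagram ^^ r) P"
    and regular: "\<forall>r<m. \<forall>i. regular_position Gt v1 (complex_of_real \<rho> * cis \<theta>) (Q r i)"
    and M: "M = matrix (frechet_derivative f (at X1))"
    and R: "R = (1 / \<tau>) *\<^sub>R M"
    and \<xi>: "\<forall>r<m. \<forall>i. \<xi> r i = (THE x. first_order_expansion G X1 \<tau> R (Q r i) x)"
    and w: "\<forall>r<m. \<forall>i. w r i = \<xi> r i - centroid n (\<xi> r)"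
    and B: "\<forall>r<m. B r = area n (w r)"
    and w_nonzero: "\<forall>r<m. \<forall>i. w r i \<noteq> 0"
    and B_pos: "\<forall>r<m. B r > 0"
    and Pn: "\<forall>k. Pn k = (normalized_pentagram n ^^ k) P"
    and C0: "C0 = centroid n P" and A0: "A0 = area n P"
    and Pt: "\<forall>q r. Pt q r = relabel (- (int q * s)) (Pn (q * m + r))"
  shows "(\<forall>k. normalized_pentagram_defined n (Pn k)) \<and>
    (\<forall>\<^sub>F x in nhds X1. aff_pt (f x) = G (aff_pt x)) \<and>
    (f differentiable (at X1)) \<and>
    (\<forall>r<m. \<forall>i q. aff_pt (affine_expr (G ^^ q) (Q r i)) = (G ^^ q) (aff_pt (Q r i))) \<and>
    (\<forall>r<m. \<forall>i. \<exists>!x. first_order_expansion G X1 \<tau> R (Q r i) x) \<and>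
    (\<forall>r<m. \<forall>i. (\<lambda>q. Pt q r i - C0 - sqrt (A0 / B r) *\<^sub>R (((*v) R ^^ q) (w r i))) \<longlonglongrightarrow> 0) \<and>
    (spectrum R = {cis \<phi>, cis (- \<phi>)}) \<and>
    (det R = 1) \<and>
    (\<exists>\<Q>. pos_def_quadratic_form \<Q> \<and> rotation_for \<Q> R \<and> (\<forall>x. \<Q> (R *v x) = \<Q> x) \<and>
       (\<forall>r<m. \<forall>i.
          ((\<lambda>q. \<Q> (Pt q r i - C0)) \<longlonglongrightarrow> A0 / B r * \<Q> (w r i)) \<and>
          ((\<lambda>q. infdist (Pt q r i - C0) {x. \<Q> x = A0 / B r * \<Q> (w r i)}) \<longlonglongrightarrow> 0)))"
proof -

  \<comment> \<open>Spectral frame and the derivative at the fixed point\<close>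
  define z where "z = complex_of_real \<rho> * cis \<theta>"
  have Imz: "Im z \<noteq> 0"
    using \<rho> \<theta> sin_gt_zero by (simp add: z_def) (metis less_irrefl)
  have lam: "lam1 \<noteq> 0" using dominant \<rho> by auto
  have \<tau>01: "0 < \<tau>" "\<tau> < 1"
    using \<tau> \<rho> dominant by auto
  have Gv1: "Gt *v v1 = lam1 *\<^sub>R v1" "v1 \<noteq> 0"
    using v1 by (simp_all add: eigenvector_def scalar_mult_eq_scaleR)
  then obtain k where "k \<noteq> 0" "homog X1 = k *\<^sub>R v1"
    using X1[symmetric] by (auto simp: aff_pt_homog proj_pt_eq_iff)
  with Gv1 have GX: "Gt *v homog X1 = lam1 *\<^sub>R homog X1"
    by (simp add: matrix_vector_mult_scaleR)
  have z: "z \<in> spectrum Gt" using spectrum by (simp add: z_def)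
  \<comment> \<open>A negative sign of \<open>lam1\<close> is absorbed by \<open>\<phi>\<close>,
    since \<open>\<tau>\<close> is defined with the absolute value.\<close>
  have z\<phi>: "z = complex_of_real (lam1 * \<tau>) * cis \<phi>"
    using \<phi> lam by (simp add: z_def field_simps)
  obtain L S where L: "linear L" and S: "invertible S" "\<And>c. S *v c = chart_part X1 (L c)"
    and GL: "\<And>c. Gt *v L c = (lam1 * \<tau>) *\<^sub>R L (rot2 \<phi> *v c)"
    and LW: "\<And>c. L c \<in> invariant_plane Gt z"
    using spectral_frame_exists[OF z Imz GX z\<phi>] by metis
  note near = affine_expr_near_fixed_point[OF G GX lam, folded f]
  have Mv: "M *v h = (1 / lam1) *\<^sub>R chart_part X1 (Gt *v (homog h - homog 0))" for h
    unfolding M frechet_derivative_at[OF near(2), symmetric]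
    using has_derivative_linear[OF near(2)] by simp
  have "(R ** S) *v c = (S ** rot2 \<phi>) *v c" for c
  proof -
    have "R *v x = (1 / \<tau>) *\<^sub>R (M *v x)" for x
      by (simp add: R scaleR_matrix_vector_assoc)
    moreover have "M *v (S *v c) = \<tau> *\<^sub>R (S *v (rot2 \<phi> *v c))"
      unfolding Mv by (rule derivative_frame[OF L GX lam GL S(2)])
    ultimately show ?thesis
      using \<tau>01 by (simp add: matrix_vector_mul_assoc[symmetric])
  qed
  then interpret conjugate_rotation R S "rot2 \<phi>"
    using S(1) rotation_matrix_rot2 by unfold_locales (auto simp: matrix_eq)

  \<comment> \<open>First-order expansions along the orbit\<close>
  let ?T = "\<lambda>k. (pentagram ^^ k) P"
  have n: "n \<ge> 1" and per: "\<And>k i. ?T k (i + int n) = ?T k i"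
    using polygon pentagram_iterate_periodic by (auto simp: polygon_def)
  have orbit: "(G ^^ q) (aff_pt (Q r i)) = aff_pt (?T (q * m + r) (i - int q * s))" for q r i
    using pentagram_projective_period[OF G periodic] iterates by (simp add: Q)
  have orbit': "affine_expr (G ^^ q) (Q r i) = ?T (q * m + r) (i - int q * s)" for q r i
    by (rule affine_expr_eqI) (simp add: orbit)
  have ex: "\<exists>x. first_order_expansion G X1 \<tau> R (Q r i) x" if "r < m" for r i
  proof -
    \<comment> \<open>With the frame coordinates of \<open>Q r i - X1\<close>, the lift of
      \<open>Q r i\<close> differs from \<open>L c\<close> by a multiple \<open>\<gamma>\<close> of
      \<open>homog X1\<close>. Regular position then excludes \<open>\<gamma> = 0\<close>.\<close>
    define c where "c = matrix_inv S *v (Q r i - X1)"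
    define \<gamma> where "\<gamma> = (homog (Q r i) - L c)$3"
    have "chart_part X1 (homog (Q r i) + (-1) *\<^sub>R L c) = 0"
      unfolding chart_part_add chart_part_scaleR chart_part_homog S(2)[symmetric] by (simp add: c_def)
    then have "homog (Q r i) - L c = \<gamma> *\<^sub>R homog X1"
      using chart_part_eq_0[of X1 "homog (Q r i) - L c"] by (simp add: \<gamma>_def)
    then have eq: "homog (Q r i) = \<gamma> *\<^sub>R homog X1 + L c"
      by (simp add: algebra_simps)
    have "regular_position Gt v1 z (Q r i)"
      using regular that by (simp add: z_def)
    then have "homog (Q r i) \<notin> invariant_plane Gt z"
      by (rule regular_position_not_in_invariant_plane[OF _ Gv1(1) Imz])
    then have "\<gamma> \<noteq> 0"
      using LW[of c] unfolding eq by (metis add_0 scaleR_zero_left)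
    then show ?thesis
      using first_order_expansion_frame[OF G GX lam L GL S(2) eq _ \<tau>01] by blast
  qed
  then have ex1: "\<exists>!x. first_order_expansion G X1 \<tau> R (Q r i) x" if "r < m" for r i
    using first_order_expansion_unique[OF \<tau>01] that by blast
  \<comment> \<open>Unique existence turns the definite description for \<open>\<xi>\<close> into an
    actual expansion.\<close>
  have \<xi>_exp: "first_order_expansion G X1 \<tau> R (Q r i) (\<xi> r i)" if "r < m" for r i
    using theI'[OF ex1[OF that]] \<xi> that by simp

  \<comment> \<open>Limits of the normalized vertices\<close>
  have A0_pos: "A0 > 0"
    using iterates[rule_format, of 0] by (simp add: A0 area_def)
  have lim: "(\<lambda>q. Pt q r i - C0 - sqrt (A0 / B r) *\<^sub>R iter q (w r i)) \<longlonglongrightarrow> 0" if r: "r < m" for r i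
  proof -
    \<comment> \<open>\<open>Y q\<close> is at once the relabelled pentagram iterate, which
      determines \<open>Pt\<close>, and the orbit of \<open>Q r\<close> under \<open>G\<close>,
      which has the expansion.\<close>
    define Y where "Y q i = ?T (q * m + r) (i + - (int q * s))" for q i
    have Y_eq: "Y q i = affine_expr (G ^^ q) (Q r i)" for q i
      by (simp add: Y_def orbit')
    have perY: "Y q (i + int n) = Y q i" for q i
      using per[of "q * m + r" "i + - (int q * s)"] by (simp add: Y_def algebra_simps)
    have cY: "centroid n (Y q) = centroid n (?T (q * m + r))"
      and aY: "area n (Y q) = area n (?T (q * m + r))" for q
      unfolding Y_def[abs_def] using per by (intro centroid_relabel area_relabel; blast)+
    have Pt_eq: "Pt q r i - C0 = sqrt (A0 / area n (Y q)) *\<^sub>R (Y q i - centroid n (Y q))" for q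
      unfolding cY aY Pt[rule_format] relabel_def Pn[rule_format]
        normalized_pentagram_iterate(1)[OF polygon iterates] C0 A0
      by (simp add: Y_def)
    have exp: "(\<lambda>q. norm (Y q i - (X1 + \<tau> ^ q *\<^sub>R iter q (\<xi> r i)))) \<in> O(\<lambda>q. \<tau> ^ (2 * q))" for i
      using \<xi>_exp[OF r] by (simp add: first_order_expansion_def Y_eq)
    have wr: "w r i = \<xi> r i - centroid n (\<xi> r)" and Br: "B r = area n (w r)" "area n (w r) > 0" for i
      using w B B_pos r by auto
    show ?thesis
      unfolding Pt_eq Br(1)
      by (rule area_normalized_limit[OF \<tau>01 n perY exp wr Br(2) A0_pos])
  qed
  have form_lim: "(\<lambda>q. form (Pt q r i - C0)) \<longlonglongrightarrow> A0 / B r * form (w r i)"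
    "(\<lambda>q. infdist (Pt q r i - C0) {x. form x = A0 / B r * form (w r i)}) \<longlonglongrightarrow> 0" if r: "r < m" for r i
  proof -
    have f: "form (sqrt (A0 / B r) *\<^sub>R w r i) = A0 / B r * form (w r i)"
      using A0_pos B_pos r by (simp add: form_scaleR less_imp_le)
    have "(\<lambda>q. (Pt q r i - C0) - iter q (sqrt (A0 / B r) *\<^sub>R w r i)) \<longlonglongrightarrow> 0"
      using lim[OF r] by (simp add: linear_scale[OF linear_iter])
    from form_tendsto[OF this]
    show "(\<lambda>q. form (Pt q r i - C0)) \<longlonglongrightarrow> A0 / B r * form (w r i)"
      "(\<lambda>q. infdist (Pt q r i - C0) {x. form x = A0 / B r * form (w r i)}) \<longlonglongrightarrow> 0"
      by (simp_all only: f)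
  qed
  have spec: "spectrum R = {cis \<phi>, cis (- \<phi>)}"
  proof -
    \<comment> \<open>Trace and determinant of \<open>R\<close> are the sum and product of
      \<open>cis \<phi>\<close> and \<open>cis (- \<phi>)\<close>, so its characteristic polynomial
      factors accordingly.\<close>
    have "trace R = 2 * cos \<phi>"
      by (simp add: trace_R) (simp add: trace_def sum_2 rot2_def)
    then have "complex_of_real (trace R) = cis \<phi> + cis (- \<phi>)" "complex_of_real (det R) = cis \<phi> * cis (- \<phi>)"
      by (simp_all add: det_R cis_mult complex_eq_iff)
    then have "x\<^sup>2 - complex_of_real (trace R) * x + complex_of_real (det R)
        = (x - cis \<phi>) * (x - cis (- \<phi>))" for x
      by (simp only:) (simp only: power2_eq_square ring_distribs algebra_simps)
    then show ?thesis by (auto simp: spectrum_2x2)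
  qed
  have "\<forall>k. normalized_pentagram_defined n (Pn k)"
    using normalized_pentagram_iterate(2)[OF polygon iterates] by (simp add: Pn)
  moreover have "f differentiable (at X1)"
    using near(2) by (auto simp: differentiable_def)
  moreover have "aff_pt (affine_expr (G ^^ q) (Q r i)) = (G ^^ q) (aff_pt (Q r i))" for q r i
    by (simp add: orbit orbit')
  ultimately show ?thesis
    using near(1) ex1 lim spec det_R pos_def_form rotation_for_form form_R form_lim by blast
qed

end
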